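(* Let $G$ be a finite group. If $\mathrm{dn}(G) > 1/2$, then $G$ is nilpotent. Moreover, the value $1/2$ is tight, i.e. it cannot be replaced by any smaller constant: for every real $c<1/2$ there exists a finite nonnilpotent group $G$ with $\mathrm{dn}(G)>c$.
   Context: For a finite group $G$, the degree of nilpotence of $G$ is the probability that two randomly chosen elements of $G$ generate a nilpotent subgroup: $$\mathrm{dn}(G)=\frac{|\{(x,y)\in G\times G : \langle x,y\rangle \text{ is nilpotent}\}|}{|G|^2}.$$ *)

theory Defs
  imports "HOL-Algebra.Algebra" Complex_Main
begin

definition commutator_subgroup :: "('a, 'b) monoid_scheme \<Rightarrow> 'a set \<Rightarrow> 'a set \<Rightarrow> 'a set"
  where "commutator_subgroup G H K =
    generate G (\<Union>h \<in> H. \<Union>k \<in> K. {h \<otimes>\<^bsub>G\<^esub> k \<otimes>\<^bsub>G\<^esub> (inv\<^bsub>G\<^esub> h) \<otimes>\<^bsub>G\<^esub> (inv\<^bsub>G\<^esub> k)})"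

(* Indexed from 0: the 0-th term is the whole group. *)
primrec lower_central_series :: "('a, 'b) monoid_scheme \<Rightarrow> nat \<Rightarrow> 'a set"
  where
    "lower_central_series G 0 = carrier G"
  | "lower_central_series G (Suc n) =
       commutator_subgroup G (lower_central_series G n) (carrier G)"

(* As for solvable, the predicate is meaningful only when G is a group; this is not built in. *)
definition nilpotent :: "('a, 'b) monoid_scheme \<Rightarrow> bool"
  where "nilpotent G \<longleftrightarrow> (\<exists>n. lower_central_series G n = {\<one>\<^bsub>G\<^esub>})"

definition dn :: "('a, 'b) monoid_scheme \<Rightarrow> real"
  where "dn G =
    real (card {(x, y) \<in> carrier G \<times> carrier G.
                  nilpotent (G\<lparr>carrier := generate G {x, y}\<rparr>)})
      / (real (order G))\<^sup>2"

end

theory Submission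
  imports Defs
begin

text \<open>Fix a prime \<open>p\<close> and a \<open>p\<close>-element \<open>u\<close> of a finite group \<open>G\<close>.  If \<open>\<langle>u, y\<rangle>\<close> is nilpotent, its
Sylow \<open>p\<close>-subgroup contains \<open>u\<close> and is normalized by \<open>y\<close>; so \<open>y\<close> lies in the subnormalizer of \<open>u\<close>, the
set of all elements that normalize some \<open>p\<close>-subgroup containing \<open>u\<close>.  A formula of Casolo
(\<open>card_subnormalizer_eq\<close>) says that the subnormalizer has the same density in \<open>G\<close> as the Sylow
\<open>p\<close>-subgroups through \<open>u\<close> have among all Sylow \<open>p\<close>-subgroups.  If that density exceeds one half, any
two conjugates of \<open>u\<close> share a Sylow \<open>p\<close>-subgroup, and the Baer-Suzuki theorem puts \<open>u\<close> into all of
them.  Hence, if \<open>u\<close> is outside the core \<open>O\<^sub>p(G)\<close>, the intersection of all Sylow \<open>p\<close>-subgroups, at most half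
of the elements of \<open>G\<close> generate a nilpotent subgroup together with \<open>u\<close>.  The inequality is even
strict, because the number of Sylow subgroups through \<open>u\<close> and the number of all of them are both
congruent to \<open>1\<close> modulo \<open>p\<close>.  This gain (\<open>card_subnormalizer_le\<close>) pays for the identity, which forms a
nilpotent pair with every element.

It remains to treat elements inside the cores.  The degree of nilpotence does not decrease when
passing to a quotient, so one may pass to \<open>G/N\<close> with \<open>N\<close> maximal among the normal subgroups not
containing the nilpotent residual (the last term of the lower central series).  In that quotient
every nontrivial normal subgroup contains the residual \<open>R \<noteq> 1\<close>.  Either all cores are trivial, and
the bound above applies to a power of prime order of each \<open>x \<noteq> 1\<close>; or exactly one core is
nontrivial, and a Frattini argument shows that it equals \<open>R\<close>, that it is abelian and that it contains all
\<open>p\<close>-elements.  Then an element \<open>x \<noteq> 1\<close> of \<open>R\<close> forms nilpotent pairs only with elements of its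
centralizer, which is a proper subgroup, while all elements outside \<open>R\<close> satisfy the strict bound.  Summing
over \<open>x\<close> gives at most half of all pairs in both cases.

For the tightness, the symmetric group of degree \<open>3\<close> is not nilpotent, and \<open>18\<close> of its \<open>36\<close> pairs
commute.\<close>

section \<open>Fixed points of p-groups\<close>

text \<open>Only the elements of \<open>H\<close> have to act: later \<open>H\<close> is a \<open>p\<close>-subgroup acting by conjugation on a set of
elements or of subgroups that need not be invariant under all of \<open>G\<close>.\<close>

lemma (in group) group_action_of_subgroup:
  assumes "subgroup H G"
    and closed: "\<And>h x. h \<in> H \<Longrightarrow> x \<in> E \<Longrightarrow> act h x \<in> E"
    and one: "\<And>x. x \<in> E \<Longrightarrow> act \<one> x = x"
    and mult: "\<And>g h x. g \<in> H \<Longrightarrow> h \<in> H \<Longrightarrow> x \<in> E \<Longrightarrow> act (g \<otimes> h) x = act g (act h x)"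
  shows "group_action (G\<lparr>carrier := H\<rparr>) E (\<lambda>g. \<lambda>x\<in>E. act g x)"
proof -
  interpret H: subgroup H G by fact
  have inv: "act (inv h) (act h x) = x" "act h (act (inv h) x) = x" if "h \<in> H" "x \<in> E"
    for h x
    using that mult[of "inv h" h x] mult[of h "inv h" x] one by auto
  have bij: "(\<lambda>x\<in>E. act h x) \<in> Bij E" if "h \<in> H" for h
  proof -
    have "bij_betw (\<lambda>x\<in>E. act h x) E E"
      by (rule bij_betw_byWitness[where f' = "act (inv h)"]) (use that inv closed in auto)
    then show ?thesis by (auto simp: Bij_def)
  qed
  have "group_hom (G\<lparr>carrier := H\<rparr>) (BijGroup E) (\<lambda>g. \<lambda>x\<in>E. act g x)"
    unfolding group_hom_def group_hom_axioms_def
  proof (intro conjI)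
    show "group (G\<lparr>carrier := H\<rparr>)" using assms(1) subgroup_imp_group by blast
    show "group (BijGroup E)" by (rule group_BijGroup)
    show "(\<lambda>g. \<lambda>x\<in>E. act g x) \<in> hom (G\<lparr>carrier := H\<rparr>) (BijGroup E)"
      using bij mult closed by (auto simp: hom_def BijGroup_def compose_def intro!: restrict_ext)
  qed
  then show ?thesis by (simp add: group_action_def)
qed

text \<open>An orbit that is not a single fixed point has length a power of \<open>p\<close> greater than \<open>1\<close>.\<close>

lemma p_group_fixed_points:
  assumes "group_action P E \<phi>" and "Factorial_Ring.prime (p::nat)" and "order P = p ^ k" and "finite E"
  shows "card {x \<in> E. \<forall>g \<in> carrier P. \<phi> g x = x} mod p = card E mod p"
proof -
  interpret group_action P E \<phi> by fact
  interpret P: group P using group_hom by (simp add: group_hom_def)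
  define F where "F = {x \<in> E. \<forall>g \<in> carrier P. \<phi> g x = x}"
  define C where "C = orbit P \<phi> ` (E - F)"
  have orb_E: "orbit P \<phi> x \<subseteq> E" if "x \<in> E" for x
    using that element_image by (auto simp: orbit_def)
  have refl: "x \<in> orbit P \<phi> x" if "x \<in> E" for x
    using that orbit_refl by blast
  have same: "orbit P \<phi> y = orbit P \<phi> x" if "x \<in> E" "y \<in> orbit P \<phi> x" for x y
  proof -
    have yE: "y \<in> E" using that orb_E by auto
    have xy: "x \<in> orbit P \<phi> y" using orbit_sym[OF that(1) yE that(2)] .
    have "z \<in> orbit P \<phi> x" if "z \<in> orbit P \<phi> y" for z
      using orbit_trans[of x y z] that \<open>x \<in> E\<close> yE \<open>y \<in> orbit P \<phi> x\<close> orb_E by blast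
    moreover have "z \<in> orbit P \<phi> y" if "z \<in> orbit P \<phi> x" for z
      using orbit_trans[of y x z] that \<open>x \<in> E\<close> yE xy orb_E by blast
    ultimately show ?thesis by blast
  qed
  have notF: "y \<notin> F" if "x \<in> E - F" "y \<in> orbit P \<phi> x" for x y
  proof
    assume "y \<in> F"
    then have "\<phi> g y = y" if "g \<in> carrier P" for g
      using that unfolding F_def by blast
    then have "orbit P \<phi> y \<subseteq> {y}"
      unfolding orbit_def by blast
    moreover have "x \<in> orbit P \<phi> y" using same[of x y] that refl[of x] by simp
    ultimately have "x = y" by blast
    with that \<open>y \<in> F\<close> show False by auto
  qed
  have U: "\<Union>C = E - F"
    using orb_E notF refl unfolding C_def by blast
  have "p dvd card (orbit P \<phi> x)" if "x \<in> E - F" for x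
  proof -
    have "card (orbit P \<phi> x) * card (stabilizer P \<phi> x) = p ^ k"
      using orbit_stabilizer_theorem[of x] that assms(3) by auto
    then obtain j where j: "card (orbit P \<phi> x) = p ^ j"
      using assms(2) divides_primepow_nat[of p "card (orbit P \<phi> x)" k] by (metis dvd_triv_left)
    have "card (orbit P \<phi> x) \<noteq> 1"
    proof
      assume "card (orbit P \<phi> x) = 1"
      then have "orbit P \<phi> x = {x}" using refl[of x] that by (auto simp: card_1_singleton_iff)
      then have "\<phi> g x = x" if "g \<in> carrier P" for g using that by (auto simp: orbit_def)
      with that show False by (auto simp: F_def)
    qed
    with j show ?thesis by (cases j) auto
  qed
  then have dvdC: "\<forall>c\<in>C. p dvd card c" by (auto simp: C_def)
  have disj: "c1 \<inter> c2 = {}" if c: "c1 \<in> C" "c2 \<in> C" "c1 \<noteq> c2" for c1 c2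
  proof (rule ccontr)
    assume "c1 \<inter> c2 \<noteq> {}"
    then obtain z where "z \<in> c1" "z \<in> c2" by blast
    moreover obtain x y where "c1 = orbit P \<phi> x" "x \<in> E" "c2 = orbit P \<phi> y" "y \<in> E"
      using c by (auto simp: C_def)
    ultimately show False using c(3) same[of x z] same[of y z] by simp
  qed
  have "finite (\<Union>C)" using assms(4) U by simp
  then have "p dvd card (\<Union>C)" using dvdC disj by (intro dvd_partition) blast+
  then have "p dvd card (E - F)" by (simp add: U)
  moreover have "card E = card F + card (E - F)"
    using assms(4) by (metis (no_types, lifting) F_def card_Diff_subset card_mono finite_subset
        le_add_diff_inverse mem_Collect_eq subsetI)
  ultimately show ?thesis unfolding F_def[symmetric]
    by (simp add: mod_add_eq[symmetric, of "card F"] dvd_imp_mod_0)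
qed

section \<open>Conjugation and normalizers\<close>

locale finite_group = group G for G (structure) +
  assumes fin: "finite (carrier G)"
begin

definition conjugate :: "'a \<Rightarrow> 'a \<Rightarrow> 'a"
  where "conjugate g x = g \<otimes> x \<otimes> inv g"

lemma conjugate_closed [simp, intro]: "g \<in> carrier G \<Longrightarrow> x \<in> carrier G \<Longrightarrow> conjugate g x \<in> carrier G"
  by (simp add: conjugate_def)

lemma conjugate_one [simp]: "x \<in> carrier G \<Longrightarrow> conjugate \<one> x = x"
  by (simp add: conjugate_def)

lemma conjugate_of_one [simp]: "g \<in> carrier G \<Longrightarrow> conjugate g \<one> = \<one>"
  by (simp add: conjugate_def)

lemma conjugate_comp: "g \<in> carrier G \<Longrightarrow> h \<in> carrier G \<Longrightarrow> x \<in> carrier G \<Longrightarrow> conjugate (g \<otimes> h) x = conjugate g (conjugate h x)"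
  by (simp add: conjugate_def m_assoc inv_mult_group)

lemma conjugate_mult: "g \<in> carrier G \<Longrightarrow> x \<in> carrier G \<Longrightarrow> y \<in> carrier G \<Longrightarrow> conjugate g (x \<otimes> y) = conjugate g x \<otimes> conjugate g y"
  by (simp add: conjugate_def m_assoc inv_solve_left)

lemma conjugate_inv [simp]:
  "g \<in> carrier G \<Longrightarrow> x \<in> carrier G \<Longrightarrow> conjugate (inv g) (conjugate g x) = x"
  "g \<in> carrier G \<Longrightarrow> x \<in> carrier G \<Longrightarrow> conjugate g (conjugate (inv g) x) = x"
  using conjugate_comp[of "inv g" g x] conjugate_comp[of g "inv g" x] by auto

lemma inv_conjugate: "g \<in> carrier G \<Longrightarrow> x \<in> carrier G \<Longrightarrow> inv (conjugate g x) = conjugate g (inv x)"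
  by (simp add: conjugate_def m_assoc inv_mult_group)

lemma conjugate_pow: "g \<in> carrier G \<Longrightarrow> x \<in> carrier G \<Longrightarrow> conjugate g (x [^] (n::nat)) = conjugate g x [^] n"
  by (induction n) (auto simp: conjugate_mult)

lemma inj_conjugate: "g \<in> carrier G \<Longrightarrow> inj_on (conjugate g) (carrier G)"
  by (metis conjugate_inv(1) inj_onI)

lemma conjugate_eq_iff: "g \<in> carrier G \<Longrightarrow> x \<in> carrier G \<Longrightarrow> conjugate g x = x \<longleftrightarrow> g \<otimes> x = x \<otimes> g"
  by (metis conjugate_def inv_solve_right m_closed)

lemma conjugate_image_comp:
  "g \<in> carrier G \<Longrightarrow> h \<in> carrier G \<Longrightarrow> A \<subseteq> carrier G \<Longrightarrow> conjugate (g \<otimes> h) ` A = conjugate g ` (conjugate h ` A)"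
  by (force simp: conjugate_comp image_image subset_eq)

lemma conjugate_image_one [simp]: "A \<subseteq> carrier G \<Longrightarrow> conjugate \<one> ` A = A"
  by (force simp: subset_eq)

lemma conjugate_image_inv [simp]:
  "g \<in> carrier G \<Longrightarrow> A \<subseteq> carrier G \<Longrightarrow> conjugate (inv g) ` (conjugate g ` A) = A"
  "g \<in> carrier G \<Longrightarrow> A \<subseteq> carrier G \<Longrightarrow> conjugate g ` (conjugate (inv g) ` A) = A"
  by (force simp: subset_eq image_image)+

lemma conjugate_image_card: "g \<in> carrier G \<Longrightarrow> A \<subseteq> carrier G \<Longrightarrow> card (conjugate g ` A) = card A"
  by (meson card_image inj_conjugate inj_on_subset)

lemma conjugate_image_eqI:
  assumes "g \<in> carrier G" "A \<subseteq> carrier G" "conjugate g ` A \<subseteq> A"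
  shows "conjugate g ` A = A"
  using assms fin by (meson card_subset_eq conjugate_image_card finite_subset)

lemma conjugate_image_subgroup:
  assumes "g \<in> carrier G" "subgroup H G"
  shows "subgroup (conjugate g ` H) G"
proof -
  interpret H: subgroup H G by fact
  show ?thesis
  proof (rule subgroupI)
    show "conjugate g ` H \<subseteq> carrier G" using assms by auto
    show "conjugate g ` H \<noteq> {}" using H.one_closed by (metis empty_iff image_is_empty)
    show "inv a \<in> conjugate g ` H" if "a \<in> conjugate g ` H" for a using that assms
      by (auto simp: inv_conjugate)
    show "a \<otimes> b \<in> conjugate g ` H"
      if "a \<in> conjugate g ` H" "b \<in> conjugate g ` H" for a b
      using that assms by (auto simp: conjugate_mult[symmetric])
  qed
qed

definition normalizer_in :: "'a set \<Rightarrow> 'a set \<Rightarrow> 'a set"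
  where "normalizer_in K A = {y \<in> K. conjugate y ` A = A}"

lemma normalizer_in_subgroup:
  assumes "subgroup K G" "A \<subseteq> carrier G"
  shows "subgroup (normalizer_in K A) G"
proof -
  interpret K: subgroup K G by fact
  show ?thesis
  proof (rule subgroupI)
    show "normalizer_in K A \<subseteq> carrier G" by (auto simp: normalizer_in_def)
    show "normalizer_in K A \<noteq> {}" using assms
      by (auto simp: normalizer_in_def intro!: exI[of _ \<one>])
    show "inv a \<in> normalizer_in K A" if "a \<in> normalizer_in K A" for a
      using that assms conjugate_image_inv(1)[of a A] by (auto simp: normalizer_in_def)
    show "a \<otimes> b \<in> normalizer_in K A"
      if "a \<in> normalizer_in K A" "b \<in> normalizer_in K A" for a b
      using that assms by (auto simp: normalizer_in_def conjugate_image_comp)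
  qed
qed

lemma normalizer_inI: "subgroup K G \<Longrightarrow> A \<subseteq> carrier G \<Longrightarrow> y \<in> K \<Longrightarrow> (\<And>x. x \<in> A \<Longrightarrow> conjugate y x \<in> A) \<Longrightarrow> y \<in> normalizer_in K A"
  unfolding normalizer_in_def using conjugate_image_eqI[of y A] by (auto dest: subgroup.subset)

lemma normalizer_in_subset: "normalizer_in K A \<subseteq> K" by (auto simp: normalizer_in_def)

lemma normalizer_in_conjugate: "y \<in> normalizer_in K A \<Longrightarrow> x \<in> A \<Longrightarrow> conjugate y x \<in> A" by (auto simp: normalizer_in_def)

lemma conjugate_subgroup_mem: "subgroup H G \<Longrightarrow> g \<in> H \<Longrightarrow> h \<in> H \<Longrightarrow> conjugate g h \<in> H"
  by (simp add: conjugate_def subgroup.m_closed subgroup.m_inv_closed)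

lemma conjugate_subgroup_image: "subgroup H G \<Longrightarrow> g \<in> H \<Longrightarrow> conjugate g ` H = H"
  by (rule conjugate_image_eqI) (auto simp: conjugate_subgroup_mem subgroup.subset subgroup.mem_carrier)

lemma subgroup_le_normalizer_in:
  assumes "subgroup H G" "H \<subseteq> K"
  shows "H \<subseteq> normalizer_in K H"
proof
  fix h assume "h \<in> H"
  then show "h \<in> normalizer_in K H" using assms conjugate_subgroup_image[OF assms(1), of h]
    by (simp add: normalizer_in_def subset_iff)
qed

lemma subgroup_mult_of_normalizer_in:
  assumes "subgroup P G" "subgroup Q G" and "Q \<subseteq> normalizer_in (carrier G) P"
  shows "subgroup (P <#> Q) G"
proof -
  interpret P: subgroup P G by fact
  interpret Q: subgroup Q G by fact
  have c: "conjugate q x \<in> P" if "q \<in> Q" "x \<in> P" for q x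
    using that assms(3) normalizer_in_conjugate by blast
  have swap: "q \<otimes> x = conjugate q x \<otimes> q" if "q \<in> Q" "x \<in> P" for q x
    using that by (simp add: conjugate_def m_assoc)
  show ?thesis
  proof (rule subgroupI)
    show "P <#> Q \<subseteq> carrier G" by (auto simp: set_mult_def)
    have "\<one> \<otimes> \<one> \<in> P <#> Q" unfolding set_mult_def
      using P.one_closed Q.one_closed by blast
    then show "P <#> Q \<noteq> {}" by (metis empty_iff)
    fix a assume "a \<in> P <#> Q"
    then obtain x q where a: "a = x \<otimes> q" "x \<in> P" "q \<in> Q"
      by (auto simp: set_mult_def)
    then have "inv a = inv q \<otimes> inv x" by (simp add: inv_mult_group)
    also have "\<dots> = conjugate (inv q) (inv x) \<otimes> inv q" using a by (intro swap) auto
    finally show "inv a \<in> P <#> Q" using a c by (auto simp: set_mult_def)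
    fix b assume "b \<in> P <#> Q"
    then obtain y r where b: "b = y \<otimes> r" "y \<in> P" "r \<in> Q"
      by (auto simp: set_mult_def)
    have "a \<otimes> b = x \<otimes> (q \<otimes> y) \<otimes> r" using a b by (simp add: m_assoc)
    also have "\<dots> = (x \<otimes> conjugate q y) \<otimes> (q \<otimes> r)"
      using a b swap[of q y] by (simp add: m_assoc)
    finally show "a \<otimes> b \<in> P <#> Q" using a b c by (auto simp: set_mult_def)
  qed
qed

end

section \<open>Sylow subgroups\<close>

context finite_group
begin

lemma subgroup_nat_pow: "subgroup H G \<Longrightarrow> x \<in> H \<Longrightarrow> x [^] (n::nat) \<in> H"
  by (induction n) (auto simp: subgroup.one_closed subgroup.m_closed)

text \<open>Being a \<open>p\<close>-group is stated through the elements, which makes it evident for subgroups and easy for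
products.  All notions are relative to a subgroup \<open>K\<close>, because the later inductions pass from \<open>K\<close> to
normalizers inside \<open>K\<close>.\<close>

definition p_subgroups :: "nat \<Rightarrow> 'a set \<Rightarrow> 'a set set"
  where "p_subgroups p K = {Q. subgroup Q G \<and> Q \<subseteq> K \<and> (\<forall>x\<in>Q. \<exists>k. x [^] (p ^ k) = \<one>)}"

text \<open>Maximality is with respect to inclusion, so that every \<open>p\<close>-subgroup lies in a Sylow subgroup for trivial reasons;
conjugacy comes from counting fixed points.\<close>

definition sylows :: "nat \<Rightarrow> 'a set \<Rightarrow> 'a set set"
  where "sylows p K = {P \<in> p_subgroups p K. \<forall>Q\<in>p_subgroups p K. P \<subseteq> Q \<longrightarrow> Q = P}"

lemma p_subgroupsD:
  assumes "Q \<in> p_subgroups p K"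
  shows "subgroup Q G" "Q \<subseteq> K" "Q \<subseteq> carrier G" "\<one> \<in> Q" "finite Q"
    "\<And>x. x \<in> Q \<Longrightarrow> \<exists>k. x [^] (p ^ k) = \<one>"
  using assms fin
    by (auto simp: p_subgroups_def dest: subgroup.subset subgroup.one_closed finite_subset)

lemma finite_p_subgroups: "finite (p_subgroups p K)"
  by (rule finite_subset[of _ "Pow (carrier G)"]) (auto simp: fin dest: p_subgroupsD(3))

lemma finite_sylows: "finite (sylows p K)"
  using finite_p_subgroups by (auto simp: sylows_def)

lemma sylowsD: "P \<in> sylows p K \<Longrightarrow> P \<in> p_subgroups p K"
  by (simp add: sylows_def)

lemma p_subgroups_mono: "Q \<in> p_subgroups p K \<Longrightarrow> Q \<subseteq> L \<Longrightarrow> Q \<in> p_subgroups p L"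
  by (simp add: p_subgroups_def)

lemma p_subgroups_subset: "Q \<in> p_subgroups p K \<Longrightarrow> subgroup H G \<Longrightarrow> H \<subseteq> Q \<Longrightarrow> H \<in> p_subgroups p K"
  by (auto simp: p_subgroups_def)

lemma one_p_subgroup: "subgroup K G \<Longrightarrow> {\<one>} \<in> p_subgroups p K"
  by (simp add: p_subgroups_def triv_subgroup subgroup.one_closed)

lemma p_subgroup_in_sylow:
  assumes "Q \<in> p_subgroups p K"
  shows "\<exists>P \<in> sylows p K. Q \<subseteq> P"
  using finite_has_maximal2[OF finite_p_subgroups assms] by (auto simp: sylows_def)

lemma conjugate_p_subgroup:
  assumes "subgroup K G" "k \<in> K" "Q \<in> p_subgroups p K"
  shows "conjugate k ` Q \<in> p_subgroups p K"
proof -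
  have k: "k \<in> carrier G" using assms by (simp add: subgroup.mem_carrier)
  have "\<exists>j. conjugate k x [^] (p ^ j) = \<one>" if x: "x \<in> Q" for x
  proof -
    obtain j where "x [^] (p ^ j) = \<one>" using p_subgroupsD(6)[OF assms(3) x] by blast
    then have "conjugate k x [^] (p ^ j) = \<one>" using k x p_subgroupsD(3)[OF assms(3)]
      by (simp add: conjugate_pow[symmetric] subset_iff)
    then show ?thesis by blast
  qed
  moreover have "conjugate k ` Q \<subseteq> K" using assms conjugate_subgroup_mem p_subgroupsD(2)
    by blast
  ultimately show ?thesis
    using k assms(3) conjugate_image_subgroup unfolding p_subgroups_def by auto
qed

lemma conjugate_sylow:
  assumes "subgroup K G" "k \<in> K" "P \<in> sylows p K"
  shows "conjugate k ` P \<in> sylows p K"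
proof -
  have k: "k \<in> carrier G" "inv k \<in> K" using assms
    by (auto simp: subgroup.mem_carrier subgroup.m_inv_closed)
  have Pc: "P \<subseteq> carrier G" using assms(3) p_subgroupsD(3) sylowsD by blast
  have "Q = conjugate k ` P" if Q: "Q \<in> p_subgroups p K" "conjugate k ` P \<subseteq> Q" for Q
  proof -
    have Qc: "Q \<subseteq> carrier G" using Q p_subgroupsD(3) by blast
    have "conjugate (inv k) ` (conjugate k ` P) \<subseteq> conjugate (inv k) ` Q" using Q(2)
      by (rule image_mono)
    then have "P \<subseteq> conjugate (inv k) ` Q" using k Pc by simp
    then have "conjugate (inv k) ` Q = P"
      using assms(3) conjugate_p_subgroup[OF assms(1) k(2) Q(1)] unfolding sylows_def by blast
    then have "conjugate k ` (conjugate (inv k) ` Q) = conjugate k ` P" by simp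
    then show ?thesis using k Qc by simp
  qed
  then show ?thesis using conjugate_p_subgroup[OF assms(1,2) sylowsD[OF assms(3)]]
    by (simp add: sylows_def)
qed

lemma card_conjugates:
  assumes "subgroup K G" "A \<subseteq> carrier G"
  shows "card ((\<lambda>k. conjugate k ` A) ` K) * card (normalizer_in K A) = card K"
proof -
  have sub: "K \<subseteq> carrier G" using assms subgroup.subset by blast
  interpret act: group_action "G\<lparr>carrier := K\<rparr>" "Pow (carrier G)" "\<lambda>k. \<lambda>A\<in>Pow (carrier G). conjugate k ` A"
    by (rule group_action_of_subgroup) (use assms sub conjugate_image_comp in \<open>auto simp: subset_iff\<close>)
  have "orbit (G\<lparr>carrier := K\<rparr>) (\<lambda>k. \<lambda>A\<in>Pow (carrier G). conjugate k ` A) A = (\<lambda>k. conjugate k ` A) ` K"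
    using assms(2) by (auto simp: orbit_def)
  moreover have "stabilizer (G\<lparr>carrier := K\<rparr>) (\<lambda>k. \<lambda>A\<in>Pow (carrier G). conjugate k ` A) A = normalizer_in K A"
    using assms(2) by (auto simp: stabilizer_def normalizer_in_def)
  ultimately show ?thesis
    using act.orbit_stabilizer_theorem[of A] assms(2) by (simp add: order_def)
qed

end

locale finite_group_at_prime = finite_group +
  fixes p :: nat
  assumes prime_p: "Factorial_Ring.prime p"
begin

abbreviation "psub \<equiv> p_subgroups p"
abbreviation "syl \<equiv> sylows p"

text \<open>If a prime \<open>q \<noteq> p\<close> divided the order, a Sylow \<open>q\<close>-subgroup would supply an element whose order is
both a power of \<open>q\<close> and a power of \<open>p\<close>.\<close>

lemma card_psub:
  assumes "Q \<in> psub K"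
  shows "\<exists>k. card Q = p ^ k"
proof (rule ccontr)
  assume no: "\<nexists>k. card Q = p ^ k"
  interpret Q: subgroup Q G using assms p_subgroupsD by blast
  interpret GQ: group "G\<lparr>carrier := Q\<rparr>" by (rule Q.subgroup_is_group) simp
  have cpos: "card Q > 0" using p_subgroupsD(4,5)[OF assms] card_gt_0_iff by blast
  obtain m where m: "card Q = p ^ multiplicity p (card Q) * m" "\<not> p dvd m"
    using multiplicity_decompose'[of "card Q" p] cpos prime_p
    by (metis less_not_refl not_prime_unit)
  then have "m \<noteq> 1" using no by auto
  then obtain q where q: "Factorial_Ring.prime q" "q dvd m" using prime_factor_nat by blast
  then have "q \<noteq> p" using m by auto
  define a where "a = multiplicity q (card Q)"
  obtain m' where m': "card Q = q ^ a * m'" unfolding a_def by (metis multiplicity_dvd dvd_def)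
  have "q dvd card Q" using q(2) by (subst m(1)) simp
  then have "a > 0" using q(1) cpos unfolding a_def
    by (metis multiplicity_eq_zero_iff not_gr_zero not_prime_unit)
  obtain H where H: "subgroup H (G\<lparr>carrier := Q\<rparr>)" "card H = q ^ a"
    using sylow_thm[of q "G\<lparr>carrier := Q\<rparr>" a m'] q(1) m' GQ.is_group p_subgroupsD(5)[OF assms]
    by (auto simp: order_def)
  have HG: "subgroup H G" using incl_subgroup[OF Q.subgroup_axioms H(1)] .
  have "card H > 1" using H(2) \<open>a > 0\<close> one_less_power[OF prime_gt_1_nat[OF q(1)]]
    by simp
  then obtain x where x: "x \<in> H" "x \<noteq> \<one>"
    by (metis card_le_Suc0_iff_eq card.infinite linorder_not_less One_nat_def less_nat_zero_code)
  have HQ: "H \<subseteq> Q" using subgroup.subset[OF H(1)] by simp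
  have xG: "x \<in> carrier G" using x HG subgroup.mem_carrier by metis
  have "x [^]\<^bsub>G\<lparr>carrier := H\<rparr>\<^esub> order (G\<lparr>carrier := H\<rparr>) = \<one>\<^bsub>G\<lparr>carrier := H\<rparr>\<^esub>"
    by (rule group.pow_order_eq_1) (use HG x in \<open>auto simp: subgroup.subgroup_is_group\<close>)
  then have "x [^] (q ^ a) = \<one>" by (simp add: order_def H(2) nat_pow_consistent[symmetric])
  moreover obtain k where "x [^] (p ^ k) = \<one>" using p_subgroupsD(6)[OF assms] x HQ by blast
  ultimately have "ord x dvd q ^ a" "ord x dvd p ^ k" using xG by (simp_all add: pow_eq_id)
  moreover have "coprime (q ^ a) (p ^ k)"
    using q(1) prime_p \<open>q \<noteq> p\<close> by (simp add: primes_coprime)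
  ultimately have "ord x = 1" using coprime_common_divisor_nat by blast
  then show False using x xG ord_eq_1 by blast
qed

lemma psub_fixed_points:
  assumes "Q \<in> psub K" "finite E"
    and closed: "\<And>h x. h \<in> Q \<Longrightarrow> x \<in> E \<Longrightarrow> act h x \<in> E"
    and one: "\<And>x. x \<in> E \<Longrightarrow> act \<one> x = x"
    and mult: "\<And>g h x. g \<in> Q \<Longrightarrow> h \<in> Q \<Longrightarrow> x \<in> E \<Longrightarrow> act (g \<otimes> h) x = act g (act h x)"
  shows "card {x \<in> E. \<forall>q\<in>Q. act q x = x} mod p = card E mod p"
proof -
  obtain k where k: "card Q = p ^ k" using card_psub assms by blast
  have "group_action (G\<lparr>carrier := Q\<rparr>) E (\<lambda>g. \<lambda>x\<in>E. act g x)"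
    by (rule group_action_of_subgroup) (use assms p_subgroupsD(1) in auto)
  from p_group_fixed_points[OF this prime_p _ assms(2), of k] k
  have "card {x \<in> E. \<forall>g\<in>Q. (\<lambda>x\<in>E. act g x) x = x} mod p = card E mod p"
    by (simp add: order_def)
  moreover have "{x \<in> E. \<forall>g\<in>Q. (\<lambda>x\<in>E. act g x) x = x} = {x \<in> E. \<forall>q\<in>Q. act q x = x}" by auto
  ultimately show ?thesis by simp
qed

lemma psub_fixed_elements:
  assumes "Q \<in> psub K" "R \<subseteq> carrier G" "\<And>q r. q \<in> Q \<Longrightarrow> r \<in> R \<Longrightarrow> conjugate q r \<in> R"
  shows "card {r \<in> R. \<forall>q\<in>Q. conjugate q r = r} mod p = card R mod p"
  using assms fin p_subgroupsD(3)[OF assms(1)]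
  by (intro psub_fixed_points[OF assms(1)]) (auto simp: finite_subset subset_iff conjugate_comp)

lemma psub_fixed_sets:
  assumes "Q \<in> psub K" "E \<subseteq> Pow (carrier G)" "\<And>q A. q \<in> Q \<Longrightarrow> A \<in> E \<Longrightarrow> conjugate q ` A \<in> E"
  shows "card {A \<in> E. Q \<subseteq> normalizer_in (carrier G) A} mod p = card E mod p"
proof -
  have Qc: "Q \<subseteq> carrier G" using p_subgroupsD(3)[OF assms(1)] .
  have "finite E" using assms(2) fin by (meson finite_Pow_iff finite_subset)
  have "card {A \<in> E. \<forall>q\<in>Q. conjugate q ` A = A} mod p = card E mod p"
  proof (rule psub_fixed_points[OF assms(1) \<open>finite E\<close>])
    show "conjugate \<one> ` A = A" if "A \<in> E" for A using that assms(2)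
      by (intro conjugate_image_one) auto
    show "conjugate (g \<otimes> h) ` A = conjugate g ` (conjugate h ` A)"
      if "g \<in> Q" "h \<in> Q" "A \<in> E" for g h A
      using that assms(2) Qc by (intro conjugate_image_comp) auto
  qed (use assms in auto)
  moreover have "{A \<in> E. \<forall>q\<in>Q. conjugate q ` A = A} = {A \<in> E. Q \<subseteq> normalizer_in (carrier G) A}"
    using Qc by (auto simp: normalizer_in_def)
  ultimately show ?thesis by simp
qed

lemma psub_mult:
  assumes "P \<in> psub K" "Q \<in> psub K" "subgroup K G" "Q \<subseteq> normalizer_in (carrier G) P"
  shows "P <#> Q \<in> psub K"
proof -
  note P = p_subgroupsD[OF assms(1)] and Q = p_subgroupsD[OF assms(2)]
  have "P <#> Q \<subseteq> K"
    using P(2) Q(2) subgroup.m_closed[OF assms(3)] unfolding set_mult_def by blast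
  moreover have "\<exists>k. a [^] (p ^ k) = \<one>" if aPQ: "a \<in> P <#> Q" for a
  proof -
    obtain x q where a: "a = x \<otimes> q" "x \<in> P" "q \<in> Q" using aPQ unfolding set_mult_def
      by blast
    have xq: "x \<in> carrier G" "q \<in> carrier G" using a P(3) Q(3) by auto
    have pw: "\<exists>z\<in>P. a [^] n = z \<otimes> q [^] n" for n :: nat
    proof (induction n)
      case 0
      then show ?case using P(4) by (intro bexI[of _ \<one>]) auto
    next
      case (Suc n)
      then obtain z where z: "z \<in> P" "a [^] n = z \<otimes> q [^] n" by blast
      have qn: "q [^] n \<in> normalizer_in (carrier G) P"
        using a(3) assms(4) normalizer_in_subgroup[OF subgroup_self P(3)]
        by (metis subsetD subgroup_nat_pow)
      define w where "w = conjugate (q [^] n) x"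
      have w: "w \<in> P" using normalizer_in_conjugate[OF qn a(2)] by (simp add: w_def)
      have zc: "z \<in> carrier G" "w \<in> carrier G" using z w P(3) by auto
      have "q [^] n \<otimes> x = w \<otimes> q [^] n" using xq
        by (simp add: w_def conjugate_def m_assoc)
      then have "a [^] Suc n = (z \<otimes> w) \<otimes> q [^] Suc n"
        using z zc xq by (simp add: a(1) m_assoc) (metis m_assoc nat_pow_closed)
      moreover have "z \<otimes> w \<in> P" using z w P(1) by (simp add: subgroup.m_closed)
      ultimately show ?case by blast
    qed
    obtain k where k: "q [^] (p ^ k) = \<one>" using Q(6) a by blast
    obtain z where z: "z \<in> P" "a [^] (p ^ k) = z" using pw[of "p ^ k"] k P(3) by auto
    obtain j where "z [^] (p ^ j) = \<one>" using P(6) z by blast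
    then have "a [^] (p ^ (k + j)) = \<one>" using z a(1) xq
      by (simp add: power_add nat_pow_pow[symmetric])
    then show ?thesis by blast
  qed
  moreover have "subgroup (P <#> Q) G" using subgroup_mult_of_normalizer_in[OF P(1) Q(1) assms(4)] .
  ultimately show ?thesis by (simp add: p_subgroups_def)
qed

text \<open>The product \<open>P <#> Q\<close> is a \<open>p\<close>-subgroup, so it cannot be larger than \<open>P\<close>.\<close>

lemma psub_normalizing_sylow:
  assumes "P \<in> syl K" "Q \<in> psub K" "subgroup K G" "Q \<subseteq> normalizer_in (carrier G) P"
  shows "Q \<subseteq> P"
proof -
  note P = p_subgroupsD[OF sylowsD[OF assms(1)]] and Q = p_subgroupsD[OF assms(2)]
  have "x \<in> P <#> Q" if "x \<in> P" for x
    using that P(3) Q(4) unfolding set_mult_def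
      by (force simp: subset_iff intro: bexI[of _ x] bexI[of _ \<one>])
  then have "P <#> Q = P"
    using psub_mult[OF sylowsD[OF assms(1)] assms(2-4)] assms(1) unfolding sylows_def by blast
  moreover have "x \<in> P <#> Q" if "x \<in> Q" for x
    using that Q(3) P(4) unfolding set_mult_def
      by (force simp: subset_iff intro: bexI[of _ x] bexI[of _ \<one>])
  ultimately show ?thesis by blast
qed

lemma one_mod_p: "1 mod p = 1"
  using prime_gt_1_nat[OF prime_p] by simp

text \<open>A \<open>p\<close>-subgroup \<open>Q\<close> acting by conjugation on the conjugates of a Sylow subgroup \<open>P\<close> fixes exactly
those that contain it, so the number of these is congruent to the number of all conjugates.
For \<open>Q = P\<close> the only one is \<open>P\<close> itself, hence all these numbers are \<open>1\<close> modulo \<open>p\<close>.\<close>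

lemma sylow_conjugates_mod_p:
  assumes "subgroup K G" "P \<in> syl K" "Q \<in> psub K"
  shows "card {A \<in> (\<lambda>k. conjugate k ` P) ` K. Q \<subseteq> A} mod p = 1"
proof -
  define E where "E = (\<lambda>k. conjugate k ` P) ` K"
  have Esyl: "A \<in> syl K" if "A \<in> E" for A using that conjugate_sylow[OF assms(1) _ assms(2)]
    by (auto simp: E_def)
  have Kc: "K \<subseteq> carrier G" using assms(1) subgroup.subset by blast
  have Pc: "P \<subseteq> carrier G" using assms(2) p_subgroupsD(3) sylowsD by blast
  have "P \<in> E" unfolding E_def using Pc subgroup.one_closed[OF assms(1)]
    by (metis conjugate_image_one imageI)
  have EPow: "E \<subseteq> Pow (carrier G)" using Kc Pc by (auto simp: E_def)
  have closed: "conjugate q ` A \<in> E" if "q \<in> K" "A \<in> E" for q A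
  proof -
    obtain k where k: "k \<in> K" "A = conjugate k ` P" using \<open>A \<in> E\<close>
      by (auto simp: E_def)
    then have "conjugate q ` A = conjugate (q \<otimes> k) ` P" using that Kc Pc
      by (subst conjugate_image_comp) auto
    moreover have "q \<otimes> k \<in> K" using that k assms(1) by (simp add: subgroup.m_closed)
    ultimately show ?thesis by (auto simp: E_def)
  qed
  have fixed: "card {A \<in> E. Q \<subseteq> A} mod p = card E mod p" if "Q \<in> psub K" for Q
  proof -
    have "{A \<in> E. Q \<subseteq> normalizer_in (carrier G) A} = {A \<in> E. Q \<subseteq> A}"
    proof (intro Collect_cong conj_cong refl iffI)
      fix A assume "A \<in> E"
      show "Q \<subseteq> A" if "Q \<subseteq> normalizer_in (carrier G) A"
        using psub_normalizing_sylow[OF Esyl \<open>Q \<in> psub K\<close> assms(1) that] \<open>A \<in> E\<close> by blast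
      show "Q \<subseteq> normalizer_in (carrier G) A" if "Q \<subseteq> A"
      proof -
        have "subgroup A G" "A \<subseteq> carrier G"
          using \<open>A \<in> E\<close> Esyl sylowsD p_subgroupsD by blast+
        then show ?thesis using subgroup_le_normalizer_in[of A "carrier G"] that by blast
      qed
    qed
    moreover have "card {A \<in> E. Q \<subseteq> normalizer_in (carrier G) A} mod p = card E mod p"
      using that p_subgroupsD(2)[OF that] closed EPow by (intro psub_fixed_sets) auto
    ultimately show ?thesis by simp
  qed
  have "{A \<in> E. P \<subseteq> A} = {P}"
    using Esyl \<open>P \<in> E\<close> assms(2) unfolding sylows_def by blast
  then have "card E mod p = 1" using fixed[OF sylowsD[OF assms(2)]] one_mod_p by simp
  then show ?thesis using fixed[OF assms(3)] by (simp add: E_def)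
qed

text \<open>A Sylow subgroup \<open>Q\<close> lies in some conjugate of \<open>P\<close>, since the number of conjugates above \<open>Q\<close> is not
\<open>0\<close> modulo \<open>p\<close>.\<close>

lemma sylows_conjugate:
  assumes "subgroup K G" "P \<in> syl K"
  shows "syl K = (\<lambda>k. conjugate k ` P) ` K"
proof
  show "(\<lambda>k. conjugate k ` P) ` K \<subseteq> syl K"
    using conjugate_sylow[OF assms(1) _ assms(2)] by blast
  show "syl K \<subseteq> (\<lambda>k. conjugate k ` P) ` K"
  proof
    fix Q assume Q: "Q \<in> syl K"
    have "card {A \<in> (\<lambda>k. conjugate k ` P) ` K. Q \<subseteq> A} \<noteq> 0"
      using sylow_conjugates_mod_p[OF assms sylowsD[OF Q]] by (metis mod_0 zero_neq_one)
    then obtain A where A: "A \<in> (\<lambda>k. conjugate k ` P) ` K" "Q \<subseteq> A"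
      by (metis (mono_tags, lifting) Collect_empty_eq card.empty)
    then have "A \<in> psub K" using conjugate_sylow[OF assms(1) _ assms(2)] sylowsD by blast
    then have "A = Q" using A(2) Q by (simp add: sylows_def)
    then show "Q \<in> (\<lambda>k. conjugate k ` P) ` K" using A by simp
  qed
qed

lemma ex_sylow: "subgroup K G \<Longrightarrow> \<exists>P. P \<in> syl K"
  using one_p_subgroup p_subgroup_in_sylow by blast

lemma card_sylows_containing:
  assumes "subgroup K G" "Q \<in> psub K"
  shows "card {P \<in> syl K. Q \<subseteq> P} mod p = 1"
  using sylow_conjugates_mod_p[OF assms(1) _ assms(2)] sylows_conjugate[OF assms(1)] ex_sylow[OF assms(1)]
  by metis

lemma card_sylows_times_normalizer:
  assumes "subgroup K G" "P \<in> syl K"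
  shows "card (syl K) * card (normalizer_in K P) = card K"
  using card_conjugates[OF assms(1) p_subgroupsD(3)[OF sylowsD[OF assms(2)]]] sylows_conjugate[OF assms]
  by simp

lemma card_normalizer_in_sylow_eq:
  assumes "subgroup K G" "P \<in> syl K" "P' \<in> syl K"
  shows "card (normalizer_in K P) = card (normalizer_in K P')"
proof -
  have "card (syl K) \<noteq> 0" using assms(2) finite_sylows by auto
  then show ?thesis
    using card_sylows_times_normalizer[OF assms(1,2)] card_sylows_times_normalizer[OF assms(1,3)]
    by (metis mult_left_cancel)
qed

lemma sum_sylow_normalizers:
  assumes "subgroup K G"
  shows "(\<Sum>P\<in>syl K. card (normalizer_in K P)) = card K"
proof -
  obtain P where P: "P \<in> syl K" using ex_sylow[OF assms] by blast
  have "(\<Sum>P'\<in>syl K. card (normalizer_in K P')) = (\<Sum>P'\<in>syl K. card (normalizer_in K P))"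
    using card_normalizer_in_sylow_eq[OF assms _ P] by simp
  then show ?thesis using card_sylows_times_normalizer[OF assms P] by simp
qed

text \<open>Normalizers grow in \<open>p\<close>-groups.  If \<open>Q\<close> were self-normalizing in \<open>Q'\<close>, the number of its conjugates
under \<open>Q'\<close> would be divisible by \<open>p\<close>, while \<open>Q\<close> would fix only itself among them.\<close>

lemma psub_growth:
  assumes "Q \<in> psub K" "Q' \<in> psub K" "Q \<subset> Q'"
  shows "Q \<subset> normalizer_in Q' Q"
proof (rule ccontr)
  note Q = p_subgroupsD[OF assms(1)] and Q' = p_subgroupsD[OF assms(2)]
  assume "\<not> Q \<subset> normalizer_in Q' Q"
  then have N: "normalizer_in Q' Q = Q" using subgroup_le_normalizer_in[OF Q(1), of Q'] assms(3)
    by auto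
  define E where "E = (\<lambda>k. conjugate k ` Q) ` Q'"
  have cE: "card E * card Q = card Q'"
    using card_conjugates[OF Q'(1) Q(3)] N by (simp add: E_def)
  have "p dvd card E"
  proof -
    obtain k where "card Q' = p ^ k" using card_psub assms(2) by blast
    then obtain j where j: "card E = p ^ j"
      using cE prime_p divides_primepow_nat[of p "card E" k] by (metis dvd_triv_left)
    have "card Q < card Q'" using assms(3) Q'(5) by (simp add: psubset_card_mono)
    then have "card E \<noteq> 1" using cE by auto
    then show ?thesis using j by (cases j) auto
  qed
  have closed: "conjugate q ` A \<in> E" if "q \<in> Q'" "A \<in> E" for q A
  proof -
    obtain k where k: "k \<in> Q'" "A = conjugate k ` Q" using \<open>A \<in> E\<close>
      by (auto simp: E_def)
    then have "conjugate q ` A = conjugate (q \<otimes> k) ` Q" using that Q(3) Q'(3)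
      by (subst conjugate_image_comp) auto
    moreover have "q \<otimes> k \<in> Q'" using that k Q'(1) by (simp add: subgroup.m_closed)
    ultimately show ?thesis by (auto simp: E_def)
  qed
  have "{A \<in> E. Q \<subseteq> normalizer_in (carrier G) A} = {Q}"
  proof (intro equalityI subsetI)
    fix A assume "A \<in> {A \<in> E. Q \<subseteq> normalizer_in (carrier G) A}"
    then obtain k where k: "k \<in> Q'" "A = conjugate k ` Q" and A: "Q \<subseteq> normalizer_in (carrier G) A"
      by (auto simp: E_def)
    have kc: "k \<in> carrier G" "inv k \<in> Q'" using k Q' by (auto simp: subgroup.m_inv_closed)
    have "conjugate (inv k) q \<in> normalizer_in Q' Q" if "q \<in> Q" for q
    proof (rule normalizer_inI[OF Q'(1) Q(3)])
      have qc: "q \<in> carrier G" using that Q(3) by auto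
      show "conjugate (inv k) q \<in> Q'" using conjugate_subgroup_mem[OF Q'(1) kc(2)] that assms(3)
        by auto
      fix x assume x: "x \<in> Q"
      then have xc: "x \<in> carrier G" using Q(3) by auto
      have "conjugate q (conjugate k x) \<in> conjugate k ` Q"
        using A that x k normalizer_in_conjugate[of q _ A "conjugate k x"] by auto
      then obtain x' where x': "x' \<in> Q" "conjugate q (conjugate k x) = conjugate k x'" by auto
      have "conjugate (conjugate (inv k) q) x = conjugate (inv k) (conjugate q (conjugate k x))"
        using kc qc xc by (simp add: conjugate_def inv_mult_group m_assoc)
      also have "\<dots> = x'" using x' Q(3) kc by auto
      finally show "conjugate (conjugate (inv k) q) x \<in> Q" using x' by simp
    qed
    then have "conjugate (inv k) ` Q \<subseteq> Q" using N by auto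
    then have "conjugate (inv k) ` Q = Q" using kc Q(3) by (intro conjugate_image_eqI) auto
    then have "conjugate k ` (conjugate (inv k) ` Q) = conjugate k ` Q" by simp
    then show "A \<in> {Q}" using kc Q(3) k by simp
  next
    fix A assume "A \<in> {Q}"
    moreover have "Q \<in> E" unfolding E_def using Q'(4) Q(3) by (metis conjugate_image_one imageI)
    ultimately show "A \<in> {A \<in> E. Q \<subseteq> normalizer_in (carrier G) A}"
      using subgroup_le_normalizer_in[OF Q(1,3)] by simp
  qed
  moreover have "card {A \<in> E. Q \<subseteq> normalizer_in (carrier G) A} mod p = card E mod p"
    using closed assms(3) Q(3) Q'(3) by (intro psub_fixed_sets[OF assms(1)]) (auto simp: E_def)
  ultimately have "1 mod p = card E mod p" by simp
  then show False using \<open>p dvd card E\<close> one_mod_p by simp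
qed

lemma generate_psub:
  assumes "subgroup K G" "u \<in> K" "u [^] (p ^ k) = \<one>"
  shows "generate G {u} \<in> psub K"
proof -
  have u: "u \<in> carrier G" using assms subgroup.mem_carrier by metis
  have "x [^] (p ^ k) = \<one>" if xu: "x \<in> generate G {u}" for x
  proof -
    obtain i :: int where "x = u [^] i" using xu unfolding generate_pow[OF u] by blast
    then have "x [^] (p ^ k) = (u [^] (p ^ k)) [^] i"
      using u by (simp add: int_pow_int[symmetric] int_pow_pow mult.commute)
    then show ?thesis using assms(3) by simp
  qed
  moreover have "generate G {u} \<subseteq> K" using assms generate_subgroup_incl by simp
  ultimately show ?thesis using u generate_is_subgroup[of "{u}"] by (auto simp: p_subgroups_def)
qed

end

section \<open>Weights on a finite family of sets\<close>

text \<open>Weights whose sum over everything above any given member is \<open>1\<close>.  They are the reduced Euler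
characteristics of the upper parts of the family, up to sign; here they are built one minimal member at a time.\<close>

lemma ex_up_weight:
  fixes \<A> :: "'b set set"
  assumes "finite \<A>"
  shows "\<exists>c :: 'b set \<Rightarrow> int. \<forall>W\<in>\<A>. (\<Sum>Q | Q \<in> \<A> \<and> W \<subseteq> Q. c Q) = 1"
  using assms
proof (induction "card \<A>" arbitrary: \<A>)
  case 0
  then show ?case by auto
next
  case (Suc n)
  then have "\<A> \<noteq> {}" by auto
  then obtain m where m: "m \<in> \<A>" "\<And>W. W \<in> \<A> \<Longrightarrow> W \<subseteq> m \<Longrightarrow> W = m"
    using finite_has_minimal[OF \<open>finite \<A>\<close>] by blast
  define B where "B = \<A> - {m}"
  have B: "finite B" "card B = n" using Suc m by (auto simp: B_def)
  with Suc(1)[of B] obtain c :: "'b set \<Rightarrow> int"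
    where c: "\<And>W. W \<in> B \<Longrightarrow> (\<Sum>Q | Q \<in> B \<and> W \<subseteq> Q. c Q) = 1" by blast
  define c' where "c' = c(m := 1 - (\<Sum>Q | Q \<in> B \<and> m \<subseteq> Q. c Q))"
  have c'B: "(\<Sum>Q | Q \<in> B \<and> W \<subseteq> Q. c' Q) = (\<Sum>Q | Q \<in> B \<and> W \<subseteq> Q. c Q)" for W
    by (rule sum.cong) (auto simp: c'_def B_def)
  have "(\<Sum>Q | Q \<in> \<A> \<and> W \<subseteq> Q. c' Q) = 1" if "W \<in> \<A>" for W
  proof (cases "W = m")
    case True
    \<comment> \<open>By minimality the new member \<open>m\<close> enters only the sum over its own upper part.\<close>
    have "{Q. Q \<in> \<A> \<and> W \<subseteq> Q} = insert m {Q. Q \<in> B \<and> m \<subseteq> Q}"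
      using True m(1) by (auto simp: B_def)
    moreover have "m \<notin> {Q. Q \<in> B \<and> m \<subseteq> Q}" by (auto simp: B_def)
    ultimately have "(\<Sum>Q | Q \<in> \<A> \<and> W \<subseteq> Q. c' Q) = c' m + (\<Sum>Q | Q \<in> B \<and> m \<subseteq> Q. c' Q)"
      using B(1) by simp
    then show ?thesis by (simp only: c'B) (simp add: c'_def)
  next
    case False
    then have "{Q. Q \<in> \<A> \<and> W \<subseteq> Q} = {Q. Q \<in> B \<and> W \<subseteq> Q}"
      using m(2)[OF that] by (auto simp: B_def)
    then show ?thesis using c[of W] False that by (simp add: c'B) (simp add: B_def)
  qed
  then show ?case by blast
qed

lemma sum_up_split:
  fixes c :: "'b set \<Rightarrow> int"
  assumes "finite \<A>" "W \<in> \<A>"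
  shows "(\<Sum>Q | Q \<in> \<A> \<and> W \<subseteq> Q. c Q) = c W + (\<Sum>Q | Q \<in> \<A> \<and> W \<subset> Q. c Q)"
proof -
  have "{Q. Q \<in> \<A> \<and> W \<subseteq> Q} = insert W {Q. Q \<in> \<A> \<and> W \<subset> Q}"
    using assms by auto
  then show ?thesis using assms(1) by simp
qed

text \<open>Moebius inversion: the value at a member is its upper sum minus the values properly above it.\<close>

lemma up_weight_unique:
  fixes f g :: "'b set \<Rightarrow> int"
  assumes "finite \<A>"
    and eq: "\<And>W. W \<in> \<A> \<Longrightarrow> (\<Sum>Q | Q \<in> \<A> \<and> W \<subseteq> Q. f Q) = (\<Sum>Q | Q \<in> \<A> \<and> W \<subseteq> Q. g Q)"
    and "W \<in> \<A>"
  shows "f W = g W"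
  using assms(3)
proof (induction "card {Q. Q \<in> \<A> \<and> W \<subset> Q}" arbitrary: W rule: less_induct)
  case less
  have "f Q = g Q" if "Q \<in> \<A>" "W \<subset> Q" for Q
  proof (rule less(1)[OF _ that(1)])
    show "card {Q'. Q' \<in> \<A> \<and> Q \<subset> Q'} < card {Q. Q \<in> \<A> \<and> W \<subset> Q}"
      by (rule psubset_card_mono) (use assms(1) that in auto)
  qed
  then have "(\<Sum>Q | Q \<in> \<A> \<and> W \<subset> Q. f Q) = (\<Sum>Q | Q \<in> \<A> \<and> W \<subset> Q. g Q)" by (intro sum.cong) auto
  then show ?case
    using eq[OF less(2)] sum_up_split[OF assms(1) less(2), of f] sum_up_split[OF assms(1) less(2), of g] by simp
qed

definition up_weight :: "'b set set \<Rightarrow> 'b set \<Rightarrow> int"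
  where "up_weight \<A> = (SOME c. \<forall>W\<in>\<A>. (\<Sum>Q | Q \<in> \<A> \<and> W \<subseteq> Q. c Q) = 1)"

lemma sum_up_weight: "finite \<A> \<Longrightarrow> W \<in> \<A> \<Longrightarrow> (\<Sum>Q | Q \<in> \<A> \<and> W \<subseteq> Q. up_weight \<A> Q) = 1"
  unfolding up_weight_def using someI_ex[OF ex_up_weight] by blast

section \<open>The subnormalizer formula\<close>

context finite_group_at_prime
begin

definition invariant_p_subgroups :: "'a set \<Rightarrow> 'a \<Rightarrow> 'a set set"
  where "invariant_p_subgroups K y = {Q \<in> psub K. y \<in> normalizer_in K Q}"

text \<open>For a \<open>p\<close>-element \<open>u\<close> and \<open>U = {u}\<close> this is the subnormalizer of \<open>\<langle>u\<rangle>\<close>, the set of all \<open>y\<close> such that \<open>\<langle>u\<rangle>\<close> is subnormal in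
\<open>\<langle>u, y\<rangle>\<close>: the latter holds iff the conjugates of \<open>u\<close> under powers of \<open>y\<close> generate a \<open>p\<close>-group, which
is then the least \<open>y\<close>-invariant \<open>p\<close>-subgroup containing \<open>u\<close>.\<close>

definition subnormalizer :: "'a set \<Rightarrow> 'a set \<Rightarrow> 'a set"
  where "subnormalizer K U = {y \<in> K. \<exists>Q \<in> invariant_p_subgroups K y. U \<subseteq> Q}"

text \<open>The total weight of \<open>Q\<close>, where each \<open>y\<close> that normalizes \<open>Q\<close> weighs \<open>Q\<close> in its own family of
\<open>y\<close>-invariant \<open>p\<close>-subgroups.\<close>

definition mass :: "'a set \<Rightarrow> 'a set \<Rightarrow> int"
  where "mass K Q = (\<Sum>y \<in> normalizer_in K Q. up_weight (invariant_p_subgroups K y) Q)"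

lemma finite_invariant_p_subgroups: "finite (invariant_p_subgroups K y)"
  by (simp add: invariant_p_subgroups_def finite_p_subgroups)

lemma invariant_p_subgroups_Inter:
  assumes "subgroup K G" "y \<in> K" "\<B> \<subseteq> invariant_p_subgroups K y" "\<B> \<noteq> {}"
  shows "\<Inter>\<B> \<in> invariant_p_subgroups K y"
proof -
  obtain B where B: "B \<in> \<B>" using assms by blast
  have ps: "Q \<in> psub K" if "Q \<in> \<B>" for Q using that assms(3)
    by (auto simp: invariant_p_subgroups_def)
  have "subgroup (\<Inter>\<B>) G"
    using ps p_subgroupsD(1) assms(4) by (intro subgroups_Inter) auto
  then have p: "\<Inter>\<B> \<in> psub K" using p_subgroups_subset[OF ps[OF B]] B by blast
  have "y \<in> normalizer_in K (\<Inter>\<B>)"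
  proof (rule normalizer_inI[OF assms(1) p_subgroupsD(3)[OF p] assms(2)])
    fix x assume x: "x \<in> \<Inter>\<B>"
    show "conjugate y x \<in> \<Inter>\<B>"
    proof
      fix Q assume "Q \<in> \<B>"
      then have "y \<in> normalizer_in K Q" "x \<in> Q" using assms(3) x
        by (auto simp: invariant_p_subgroups_def)
      then show "conjugate y x \<in> Q" by (rule normalizer_in_conjugate)
    qed
  qed
  with p show ?thesis by (simp add: invariant_p_subgroups_def)
qed

text \<open>For fixed \<open>y\<close> the \<open>y\<close>-invariant \<open>p\<close>-subgroups containing \<open>U\<close> are either absent or have a least member,
their intersection; so their weights sum to \<open>0\<close> or \<open>1\<close> according to membership of \<open>y\<close> in the subnormalizer.\<close>

lemma card_subnormalizer:
  assumes "subgroup K G"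
  shows "int (card (subnormalizer K U)) = (\<Sum>Q | Q \<in> psub K \<and> U \<subseteq> Q. mass K Q)"
proof -
  have finK: "finite K" using assms fin by (meson finite_subset subgroup.subset)
  have inner: "(\<Sum>Q | Q \<in> {Q \<in> psub K. U \<subseteq> Q} \<and> y \<in> normalizer_in K Q. up_weight (invariant_p_subgroups K y) Q)
      = (if y \<in> subnormalizer K U then 1 else 0)" if "y \<in> K" for y
  proof -
    have set: "{Q. Q \<in> {Q \<in> psub K. U \<subseteq> Q} \<and> y \<in> normalizer_in K Q} = {Q \<in> invariant_p_subgroups K y. U \<subseteq> Q}"
      by (auto simp: invariant_p_subgroups_def)
    show ?thesis
    proof (cases "y \<in> subnormalizer K U")
      case False
      then have "{Q \<in> invariant_p_subgroups K y. U \<subseteq> Q} = {}" using that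
        by (auto simp: subnormalizer_def)
      then show ?thesis using False unfolding set by (metis sum.empty)
    next
      case True
      define W where "W = \<Inter>{Q \<in> invariant_p_subgroups K y. U \<subseteq> Q}"
      have "W \<in> invariant_p_subgroups K y" unfolding W_def
        by (rule invariant_p_subgroups_Inter[OF assms that]) (use True in \<open>auto simp: subnormalizer_def\<close>)
      moreover have "{Q \<in> invariant_p_subgroups K y. U \<subseteq> Q} = {Q. Q \<in> invariant_p_subgroups K y \<and> W \<subseteq> Q}"
        unfolding W_def by blast
      ultimately show ?thesis unfolding set
        using True sum_up_weight[OF finite_invariant_p_subgroups] by simp
    qed
  qed
  have "(\<Sum>Q | Q \<in> psub K \<and> U \<subseteq> Q. mass K Q)
      = (\<Sum>Q \<in> {Q \<in> psub K. U \<subseteq> Q}. \<Sum>y | y \<in> K \<and> y \<in> normalizer_in K Q. up_weight (invariant_p_subgroups K y) Q)"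
    unfolding mass_def by (intro sum.cong) (auto simp: normalizer_in_def)
  also have "\<dots> = (\<Sum>y\<in>K. \<Sum>Q | Q \<in> {Q \<in> psub K. U \<subseteq> Q} \<and> y \<in> normalizer_in K Q. up_weight (invariant_p_subgroups K y) Q)"
    using finK finite_p_subgroups by (intro sum.swap_restrict) auto
  also have "\<dots> = (\<Sum>y\<in>K. if y \<in> subnormalizer K U then 1 else 0)"
    by (rule sum.cong) (simp_all only: inner)
  also have "\<dots> = int (card (K \<inter> subnormalizer K U))" using finK
    by (simp add: sum.If_cases)
  also have "K \<inter> subnormalizer K U = subnormalizer K U" by (auto simp: subnormalizer_def)
  finally show ?thesis by simp
qed

text \<open>The weight of \<open>Q\<close> depends only on the invariant \<open>p\<close>-subgroups properly above \<open>Q\<close>.  Intersecting these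
with the normalizer \<open>N\<close> of \<open>Q\<close> maps them onto those inside \<open>N\<close>, properness being preserved because
normalizers grow; and pushing the weights forward along this map gives weights for \<open>N\<close>, which are unique.\<close>

lemma mass_local:
  assumes "subgroup K G" "Q \<in> psub K"
  shows "mass K Q = mass (normalizer_in K Q) Q"
proof -
  define N where "N = normalizer_in K Q"
  note Q = p_subgroupsD[OF assms(2)]
  have N: "subgroup N G" "N \<subseteq> K"
    using normalizer_in_subgroup[OF assms(1) Q(3)] normalizer_in_subset by (auto simp: N_def)
  have QN: "Q \<subseteq> N" using subgroup_le_normalizer_in[OF Q(1,2)] by (simp add: N_def)
  have NN: "normalizer_in N Q = N" by (auto simp: N_def normalizer_in_def)
  have "up_weight (invariant_p_subgroups K y) Q = up_weight (invariant_p_subgroups N y) Q"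
    if y: "y \<in> N" for y
  proof -
    define c where "c = up_weight (invariant_p_subgroups K y)"
    define d where "d = up_weight (invariant_p_subgroups N y)"
    \<comment> \<open>The weights for \<open>K\<close> pushed forward along the intersection with \<open>N\<close>.\<close>
    define g where "g R = (\<Sum>Q' | Q' \<in> {Q' \<in> invariant_p_subgroups K y. Q \<subset> Q'} \<and> Q' \<inter> N = R. c Q')" for R
    have yK: "y \<in> K" using y N by auto
    have sub: "invariant_p_subgroups N y \<subseteq> invariant_p_subgroups K y"
      using N(2)
        by (auto simp: invariant_p_subgroups_def normalizer_in_def dest: p_subgroups_mono p_subgroupsD(2))
        (meson p_subgroupsD(2) p_subgroups_mono subset_trans)
    have QK: "Q \<in> invariant_p_subgroups K y" using y assms(2)
      by (simp add: invariant_p_subgroups_def N_def)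
    have QinN: "Q \<in> invariant_p_subgroups N y" using y assms(2) QN NN
      by (auto simp: invariant_p_subgroups_def dest: p_subgroups_mono)
    define \<R> where "\<R> = {R \<in> invariant_p_subgroups N y. Q \<subset> R}"
    have fR: "finite \<R>" by (simp add: \<R>_def finite_invariant_p_subgroups)
    have meet: "Q' \<inter> N \<in> \<R>"
      if Q': "Q' \<in> invariant_p_subgroups K y" "Q \<subset> Q'" for Q'
    proof -
      have Q'p: "Q' \<in> psub K" and yQ': "y \<in> normalizer_in K Q'" using Q'
        by (auto simp: invariant_p_subgroups_def)
      note P = p_subgroupsD[OF Q'p]
      have "subgroup (Q' \<inter> N) G" using subgroups_Inter_pair P(1) N(1) by blast
      then have mp: "Q' \<inter> N \<in> psub K" by (rule p_subgroups_subset[OF Q'p]) auto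
      then have m: "Q' \<inter> N \<in> psub N" by (rule p_subgroups_mono) auto
      have "y \<in> normalizer_in N (Q' \<inter> N)"
        using normalizer_in_conjugate[OF yQ'] conjugate_subgroup_mem[OF N(1) y] p_subgroupsD(3)[OF m]
        by (intro normalizer_inI[OF N(1) _ y]) auto
      moreover have "Q \<subset> Q' \<inter> N"
        using psub_growth[OF assms(2) Q'p Q'(2)] P(2) by (auto simp: N_def normalizer_in_def)
      ultimately show ?thesis using m by (simp add: \<R>_def invariant_p_subgroups_def)
    qed
    have sum_g: "(\<Sum>R | R \<in> \<R> \<and> W \<subseteq> R. g R) = (\<Sum>Q' | Q' \<in> invariant_p_subgroups K y \<and> Q \<subset> Q' \<and> W \<subseteq> Q'. c Q')"
      if "W \<subseteq> N" for W
    proof -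
      have "(\<Sum>R | R \<in> \<R> \<and> W \<subseteq> R. g R)
        = (\<Sum>R \<in> {R. R \<in> \<R> \<and> W \<subseteq> R}. \<Sum>Q' | Q' \<in> {Q' \<in> invariant_p_subgroups K y. Q \<subset> Q' \<and> W \<subseteq> Q'} \<and> Q' \<inter> N = R. c Q')"
        unfolding g_def by (intro sum.cong refl) auto
      also have "\<dots> = (\<Sum>Q' \<in> {Q' \<in> invariant_p_subgroups K y. Q \<subset> Q' \<and> W \<subseteq> Q'}. c Q')"
        by (rule sum.group) (use finite_invariant_p_subgroups fR meet that in auto)
      finally show ?thesis .
    qed
    have "d R = g R" if "R \<in> \<R>" for R
    proof (rule up_weight_unique[OF fR _ that])
      fix W assume W: "W \<in> \<R>"
      have WN: "W \<in> invariant_p_subgroups N y" "Q \<subset> W" "W \<subseteq> N"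
        using W p_subgroupsD(2) by (auto simp: \<R>_def invariant_p_subgroups_def)
      have "{R. R \<in> \<R> \<and> W \<subseteq> R} = {R. R \<in> invariant_p_subgroups N y \<and> W \<subseteq> R}" using WN by (auto simp: \<R>_def)
      then have "(\<Sum>R | R \<in> \<R> \<and> W \<subseteq> R. d R) = 1"
        using sum_up_weight[OF finite_invariant_p_subgroups WN(1)] by (simp add: d_def)
      moreover have "{Q'. Q' \<in> invariant_p_subgroups K y \<and> Q \<subset> Q' \<and> W \<subseteq> Q'} = {Q'. Q' \<in> invariant_p_subgroups K y \<and> W \<subseteq> Q'}"
        using WN by auto
      then have "(\<Sum>R | R \<in> \<R> \<and> W \<subseteq> R. g R) = 1"
        using sum_g[OF WN(3)] sum_up_weight[OF finite_invariant_p_subgroups, of W K y] WN(1) sub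
          by (auto simp: c_def)
      ultimately show "(\<Sum>R | R \<in> \<R> \<and> W \<subseteq> R. d R) = (\<Sum>R | R \<in> \<R> \<and> W \<subseteq> R. g R)" by simp
    qed
    then have "(\<Sum>R | R \<in> \<R> \<and> {} \<subseteq> R. d R) = (\<Sum>R | R \<in> \<R> \<and> {} \<subseteq> R. g R)"
      by (intro sum.cong) auto
    also have "\<dots> = (\<Sum>Q' | Q' \<in> invariant_p_subgroups K y \<and> Q \<subset> Q'. c Q')" using sum_g[of "{}"] by simp
    finally have "(\<Sum>R | R \<in> invariant_p_subgroups N y \<and> Q \<subset> R. d R) = (\<Sum>Q' | Q' \<in> invariant_p_subgroups K y \<and> Q \<subset> Q'. c Q')"
      by (simp add: \<R>_def)
    then show ?thesis
      using sum_up_split[OF finite_invariant_p_subgroups QK, of c] sum_up_split[OF finite_invariant_p_subgroups QinN, of d]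
        sum_up_weight[OF finite_invariant_p_subgroups QK] sum_up_weight[OF finite_invariant_p_subgroups QinN]
      by (simp add: c_def d_def)
  qed
  then have "mass K Q = (\<Sum>y\<in>N. up_weight (invariant_p_subgroups N y) Q)"
    by (simp add: mass_def N_def)
  also have "\<dots> = mass N Q" by (simp add: mass_def NN)
  finally show ?thesis by (simp add: N_def)
qed

lemma mass_sylow:
  assumes "subgroup K G" "P \<in> syl K"
  shows "mass K P = int (card (normalizer_in K P))"
proof -
  have "up_weight (invariant_p_subgroups K y) P = 1" if "y \<in> normalizer_in K P" for y
  proof -
    have P: "P \<in> invariant_p_subgroups K y" using that assms(2)
      by (simp add: invariant_p_subgroups_def sylows_def)
    have "{Q. Q \<in> invariant_p_subgroups K y \<and> P \<subseteq> Q} = {P}"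
      using P assms(2) by (auto simp: invariant_p_subgroups_def sylows_def)
    then show ?thesis using sum_up_weight[OF finite_invariant_p_subgroups P] by simp
  qed
  then show ?thesis by (simp add: mass_def)
qed

text \<open>By the locality of the mass one may replace \<open>K\<close> by the normalizer \<open>N\<close> of \<open>Q\<close>.  There every element
normalizes \<open>Q\<close>, so the masses of all \<open>p\<close>-subgroups from \<open>Q\<close> on sum to \<open>card N\<close>; by induction only \<open>Q\<close> and the Sylow
subgroups contribute, and the Sylow subgroups alone already contribute \<open>card N\<close>.\<close>

lemma mass_non_sylow:
  assumes "subgroup K G" "Q \<in> psub K" "Q \<notin> syl K"
  shows "mass K Q = 0"
  using assms
proof (induction "card K - card Q" arbitrary: K Q rule: less_induct)
  case less
  define N where "N = normalizer_in K Q"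
  note Q = p_subgroupsD[OF less.prems(2)]
  have N: "subgroup N G" "N \<subseteq> K"
    using normalizer_in_subgroup[OF less.prems(1) Q(3)] normalizer_in_subset by (auto simp: N_def)
  have QN: "Q \<subseteq> N" using subgroup_le_normalizer_in[OF Q(1,2)] by (simp add: N_def)
  have NN: "normalizer_in N Q = N" by (auto simp: N_def normalizer_in_def)
  have finK: "finite K" using less.prems(1) fin by (meson finite_subset subgroup.subset)
  have Qp: "Q \<in> psub N" using less.prems(2) QN by (rule p_subgroups_mono)
  have Qn: "Q \<notin> syl N"
  proof
    assume Qs: "Q \<in> syl N"
    obtain P where P: "P \<in> psub K" "Q \<subset> P" using less.prems(2,3)
      by (auto simp: sylows_def)
    have "subgroup (P \<inter> N) G" using subgroups_Inter_pair p_subgroupsD(1)[OF P(1)] N(1)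
      by blast
    then have "P \<inter> N \<in> psub K" by (rule p_subgroups_subset[OF P(1)]) auto
    then have "P \<inter> N \<in> psub N" by (rule p_subgroups_mono) auto
    moreover have "Q \<subset> P \<inter> N"
      using psub_growth[OF less.prems(2) P] p_subgroupsD(2)[OF P(1)]
        by (auto simp: N_def normalizer_in_def)
    ultimately show False using Qs by (auto simp: sylows_def)
  qed
  have above: "Q \<subseteq> P" if P: "P \<in> syl N" for P
  proof -
    obtain S where S: "S \<in> syl N" "Q \<subseteq> S" using p_subgroup_in_sylow[OF Qp] by blast
    then obtain n where n: "n \<in> N" "P = conjugate n ` S" using sylows_conjugate[OF N(1) S(1)] P
      by auto
    have "conjugate n ` Q = Q" using n(1) NN by (auto simp: normalizer_in_def)
    then show ?thesis using n(2) S(2) by (metis image_mono)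
  qed
  have catch: "subnormalizer N Q = N"
    using Qp NN by (auto simp: subnormalizer_def invariant_p_subgroups_def)
  have zero: "mass N Q' = 0" if "Q' \<in> psub N" "Q \<subset> Q'" "Q' \<notin> syl N" for Q'
  proof (rule less.hyps[OF _ N(1) that(1,3)])
    have c1: "card Q < card Q'" using that p_subgroupsD(5)[OF that(1)]
      by (simp add: psubset_card_mono)
    have c2: "card Q' \<le> card N" using p_subgroupsD(2)[OF that(1)] finK N(2)
      by (meson card_mono finite_subset)
    have c3: "card N \<le> card K" using finK N(2) by (rule card_mono)
    show "card N - card Q' < card K - card Q" using c1 c2 c3 by linarith
  qed
  have "int (card N) = (\<Sum>Q' | Q' \<in> psub N \<and> Q \<subseteq> Q'. mass N Q')"
    using card_subnormalizer[OF N(1), of Q] catch by simp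
  also have "\<dots> = mass N Q + (\<Sum>Q' | Q' \<in> psub N \<and> Q \<subset> Q'. mass N Q')"
    by (rule sum_up_split[OF finite_p_subgroups Qp])
  also have "(\<Sum>Q' | Q' \<in> psub N \<and> Q \<subset> Q'. mass N Q') = (\<Sum>P\<in>syl N. mass N P)"
    using zero above Qn finite_p_subgroups
    by (intro sum.mono_neutral_right) (auto simp: sylows_def)
  also have "\<dots> = (\<Sum>P\<in>syl N. int (card (normalizer_in N P)))"
    using mass_sylow[OF N(1)] by (intro sum.cong) auto
  also have "\<dots> = int (card N)" using sum_sylow_normalizers[OF N(1)] by (metis of_nat_sum)
  finally have "mass N Q = 0" by simp
  then show ?case using mass_local[OF less.prems(1,2)] by (simp add: N_def)
qed

text \<open>Casolo's formula.  It follows since only Sylow subgroups carry mass.\<close>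

theorem card_subnormalizer_eq:
  assumes "subgroup K G" "P \<in> syl K"
  shows "card (subnormalizer K U) = card {P' \<in> syl K. U \<subseteq> P'} * card (normalizer_in K P)"
proof -
  have "int (card (subnormalizer K U)) = (\<Sum>Q | Q \<in> psub K \<and> U \<subseteq> Q. mass K Q)" by (rule card_subnormalizer[OF assms(1)])
  also have "\<dots> = (\<Sum>Q | Q \<in> syl K \<and> U \<subseteq> Q. mass K Q)"
    using mass_non_sylow[OF assms(1)] finite_p_subgroups
    by (intro sum.mono_neutral_right) (auto simp: sylows_def)
  also have "\<dots> = (\<Sum>Q | Q \<in> syl K \<and> U \<subseteq> Q. int (card (normalizer_in K P)))"
    using mass_sylow[OF assms(1)] card_normalizer_in_sylow_eq[OF assms(1) _ assms(2)]
      by (intro sum.cong) auto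
  also have "\<dots> = int (card {P' \<in> syl K. U \<subseteq> P'} * card (normalizer_in K P))"
    by simp
  finally show ?thesis by linarith
qed

end

section \<open>Elements in more than half of the Sylow subgroups\<close>

context finite_group
begin

lemma normalizer_in_le_normalizer_in_generate:
  assumes "D \<subseteq> carrier G"
  shows "normalizer_in (carrier G) D \<subseteq> normalizer_in (carrier G) (generate G D)"
proof
  fix t assume t: "t \<in> normalizer_in (carrier G) D"
  then have tc: "t \<in> carrier G" "conjugate t ` D = D" by (auto simp: normalizer_in_def)
  have Dg: "subgroup (generate G D) G" "generate G D \<subseteq> carrier G"
    using assms generate_is_subgroup generate_incl by auto
  have "D \<subseteq> conjugate t ` generate G D" using tc(2) generate.incl
    by (metis image_mono subsetI)
  then have "generate G D \<subseteq> conjugate t ` generate G D"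
    using conjugate_image_subgroup[OF tc(1) Dg(1)] by (rule generate_subgroup_incl)
  then have "conjugate t ` generate G D = generate G D"
    using conjugate_image_card[OF tc(1) Dg(2)] fin Dg(2)
    by (metis card_subset_eq finite_imageI finite_subset)
  then show "t \<in> normalizer_in (carrier G) (generate G D)" using tc
    by (simp add: normalizer_in_def)
qed

end

context finite_group_at_prime
begin

text \<open>Let \<open>C\<close> be a union of conjugacy classes.  Inside a \<open>p\<close>-group \<open>P\<close>, the trace \<open>D\<close> of \<open>C\<close> on a
subgroup is normalized by some further element of \<open>C\<close>: otherwise the normalizer of \<open>D\<close> in \<open>P\<close> meets
\<open>C\<close> in \<open>D\<close> only, so its own normalizer also normalizes \<open>D\<close>, which contradicts the growth of normalizers.\<close>

lemma psub_escape:
  assumes "P \<in> psub K" "subgroup M G"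
    and C: "C \<subseteq> carrier G" "\<And>g x. g \<in> carrier G \<Longrightarrow> x \<in> C \<Longrightarrow> conjugate g x \<in> C"
    and "D = C \<inter> M" "D \<subset> C \<inter> P"
  shows "\<exists>x \<in> C \<inter> P. x \<notin> D \<and> x \<in> normalizer_in (carrier G) D"
proof (rule ccontr)
  assume no: "\<not> ?thesis"
  note P = p_subgroupsD[OF assms(1)]
  have Dc: "D \<subseteq> carrier G" using assms(5) C(1) by auto
  define E where "E = normalizer_in P D"
  have E: "subgroup E G" "E \<subseteq> P"
    using normalizer_in_subgroup[OF P(1) Dc] normalizer_in_subset by (auto simp: E_def)
  have Ep: "E \<in> psub K" using p_subgroups_subset[OF assms(1) E] .
  have "C \<inter> E \<subseteq> D" using no P(3) by (auto simp: E_def normalizer_in_def)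
  have "D \<subseteq> E"
  proof
    fix d assume d: "d \<in> D"
    have dM: "d \<in> M" "d \<in> P" "d \<in> carrier G" using d assms Dc by auto
    have "conjugate d x \<in> D" if "x \<in> D" for x
      using that C(2)[OF dM(3)] conjugate_subgroup_mem[OF assms(2) dM(1)] by (simp add: assms(5))
    then show "d \<in> E" unfolding E_def by (intro normalizer_inI[OF P(1) Dc dM(2)])
  qed
  have "E \<noteq> P" using \<open>C \<inter> E \<subseteq> D\<close> assms(6) by auto
  then have "E \<subset> normalizer_in P E" using E psub_growth[OF Ep assms(1)] by auto
  then obtain n where n: "n \<in> normalizer_in P E" "n \<notin> E" by auto
  have nP: "n \<in> P" "n \<in> carrier G" using n normalizer_in_subset P(3) by auto
  have "conjugate n d \<in> D" if "d \<in> D" for d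
  proof -
    have "conjugate n d \<in> E"
      using normalizer_in_conjugate[OF n(1)] that \<open>D \<subseteq> E\<close> by auto
    moreover have "conjugate n d \<in> C" using that C(2)[OF nP(2)] by (simp add: assms(5))
    ultimately show ?thesis using \<open>C \<inter> E \<subseteq> D\<close> by auto
  qed
  then have "n \<in> E" unfolding E_def by (intro normalizer_inI[OF P(1) Dc nP(1)])
  with n show False by simp
qed

abbreviation "Syl \<equiv> syl (carrier G)"

lemma card_sylows_containing_conjugate:
  assumes "u \<in> carrier G" "g \<in> carrier G"
  shows "card {P \<in> Syl. conjugate g u \<in> P} = card {P \<in> Syl. u \<in> P}"
proof (rule bij_betw_same_card[symmetric])
  show "bij_betw (\<lambda>P. conjugate g ` P) {P \<in> Syl. u \<in> P} {P \<in> Syl. conjugate g u \<in> P}"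
  proof (rule bij_betw_byWitness[where f' = "\<lambda>P. conjugate (inv g) ` P"])
    have S: "P \<subseteq> carrier G" if "P \<in> Syl" for P using that sylowsD p_subgroupsD(3)
      by blast
    show "\<forall>P\<in>{P \<in> Syl. u \<in> P}. conjugate (inv g) ` conjugate g ` P = P"
      "\<forall>P\<in>{P \<in> Syl. conjugate g u \<in> P}. conjugate g ` conjugate (inv g) ` P = P"
      using S assms(2) by auto
    show "(\<lambda>P. conjugate g ` P) ` {P \<in> Syl. u \<in> P} \<subseteq> {P \<in> Syl. conjugate g u \<in> P}"
      using conjugate_sylow[OF subgroup_self assms(2)] by auto
    have "u \<in> conjugate (inv g) ` P" if "conjugate g u \<in> P" for P
      using that assms by (metis conjugate_inv(1) imageI)
    then show "(\<lambda>P. conjugate (inv g) ` P) ` {P \<in> Syl. conjugate g u \<in> P} \<subseteq> {P \<in> Syl. u \<in> P}"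
      using conjugate_sylow[OF subgroup_self inv_closed[OF assms(2)]] by auto
  qed
qed

text \<open>The argument of Alperin and Lyons.  Among the pairs of Sylow subgroups that meet the conjugacy class
\<open>C\<close> of \<open>u\<close> in different sets, take \<open>P\<close>, \<open>Q\<close> with the largest common part \<open>D\<close>.  Some elements \<open>x\<close> of \<open>P\<close>
and \<open>y\<close> of \<open>Q\<close> in \<open>C - D\<close> normalize \<open>D\<close>; they share a Sylow subgroup, and so some Sylow subgroup \<open>R\<close>
contains \<open>D\<close>, \<open>x\<close> and \<open>y\<close>.  By maximality \<open>R\<close> meets \<open>C\<close> in the same set as \<open>P\<close> and in the same set as \<open>Q\<close>.\<close>

lemma baer_suzuki:
  assumes "u \<in> carrier G"
    and pair: "\<And>g h. g \<in> carrier G \<Longrightarrow> h \<in> carrier G \<Longrightarrow> \<exists>P\<in>Syl. conjugate g u \<in> P \<and> conjugate h u \<in> P"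
    and "P \<in> Syl"
  shows "u \<in> P"
proof -
  define C where "C = (\<lambda>g. conjugate g u) ` carrier G"
  have C: "C \<subseteq> carrier G" using assms(1) by (auto simp: C_def)
  have Ccl: "conjugate g x \<in> C" if "g \<in> carrier G" "x \<in> C" for g x
    using that assms(1) by (auto simp: C_def conjugate_comp[symmetric])
  have uC: "u \<in> C" unfolding C_def using assms(1) by (metis conjugate_one imageI one_closed)
  have S: "subgroup P G" "P \<subseteq> carrier G" "P \<in> psub (carrier G)" if "P \<in> Syl" for P
    using sylowsD[OF that] p_subgroupsD by auto
  have cardC: "card (C \<inter> P) = card (C \<inter> Q)" if P: "P \<in> Syl" and Q: "Q \<in> Syl"
    for P Q
  proof -
    obtain g where g: "g \<in> carrier G" "Q = conjugate g ` P"
      using sylows_conjugate[OF subgroup_self P] Q by auto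
    have "conjugate g ` (C \<inter> P) = C \<inter> Q"
    proof
      show "conjugate g ` (C \<inter> P) \<subseteq> C \<inter> Q" using Ccl[OF g(1)] g(2) by auto
      show "C \<inter> Q \<subseteq> conjugate g ` (C \<inter> P)"
      proof
        fix z assume z: "z \<in> C \<inter> Q"
        then obtain x where x: "x \<in> P" "z = conjugate g x" using g by auto
        then have "x = conjugate (inv g) z" using g S[OF P] by auto
        then have "x \<in> C" using Ccl[of "inv g" z] z g by auto
        then show "z \<in> conjugate g ` (C \<inter> P)" using x by auto
      qed
    qed
    then show ?thesis using conjugate_image_card[OF g(1), of "C \<inter> P"] C
      by (simp add: le_infI1)
  qed
  have eq: "C \<inter> P = C \<inter> Q" if "P \<in> Syl" "Q \<in> Syl" for P Q
  proof (rule ccontr)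
    assume ne: "C \<inter> P \<noteq> C \<inter> Q"
    define Z where "Z = {(P, Q). P \<in> Syl \<and> Q \<in> Syl \<and> C \<inter> P \<noteq> C \<inter> Q}"
    have finZ: "finite Z"
      by (rule finite_subset[of _ "Syl \<times> Syl"]) (auto simp: Z_def finite_sylows)
    define m where "m = (\<lambda>w. card (C \<inter> fst w \<inter> snd w))"
    have "Z \<noteq> {}" using ne that by (auto simp: Z_def)
    then obtain z where z: "z \<in> Z" "m z = Max (m ` Z)" using Max_in[of "m ` Z"] finZ
      by fastforce
    have z_max: "m w \<le> m z" if "w \<in> Z" for w using z(2) that finZ by simp
    define P where "P = fst z"
    define Q where "Q = snd z"
    have PQ: "P \<in> Syl" "Q \<in> Syl" "C \<inter> P \<noteq> C \<inter> Q" using z(1)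
      by (auto simp: P_def Q_def Z_def)
    define D where "D = C \<inter> (P \<inter> Q)"
    have max: "C \<inter> P' = C \<inter> Q'"
      if "P' \<in> Syl" "Q' \<in> Syl" "D \<subset> C \<inter> P' \<inter> Q'" for P' Q'
    proof (rule ccontr)
      assume "C \<inter> P' \<noteq> C \<inter> Q'"
      then have "(P', Q') \<in> Z" using that by (auto simp: Z_def)
      then have "card (C \<inter> P' \<inter> Q') \<le> card D" using z_max[of "(P', Q')"]
        by (simp add: m_def D_def P_def Q_def Int_assoc)
      moreover have "card D < card (C \<inter> P' \<inter> Q')"
        using that(3) C fin by (intro psubset_card_mono) (auto intro: finite_subset)
      ultimately show False by simp
    qed
    have Dc: "D \<subseteq> carrier G" using C by (auto simp: D_def)
    have finC: "finite C" using C fin by (rule finite_subset)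
    have DP: "D \<subset> C \<inter> P"
    proof (rule psubsetI)
      show "D \<noteq> C \<inter> P"
      proof
        assume "D = C \<inter> P"
        then have "C \<inter> P \<subseteq> C \<inter> Q" by (auto simp: D_def)
        then show False using cardC[OF PQ(1,2)] finC PQ(3) by (metis card_subset_eq finite_Int)
      qed
    qed (auto simp: D_def)
    have DQ: "D \<subset> C \<inter> Q"
    proof (rule psubsetI)
      show "D \<noteq> C \<inter> Q"
      proof
        assume "D = C \<inter> Q"
        then have "C \<inter> Q \<subseteq> C \<inter> P" by (auto simp: D_def)
        then show False using cardC[OF PQ(1,2)] finC PQ(3) by (metis card_subset_eq finite_Int)
      qed
    qed (auto simp: D_def)
    have sPQ: "subgroup (P \<inter> Q) G" using subgroups_Inter_pair S(1) PQ by blast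
    obtain x where x: "x \<in> C \<inter> P" "x \<notin> D" "x \<in> normalizer_in (carrier G) D"
      using psub_escape[OF S(3)[OF PQ(1)] sPQ C Ccl D_def DP] by blast
    obtain y where y: "y \<in> C \<inter> Q" "y \<notin> D" "y \<in> normalizer_in (carrier G) D"
      using psub_escape[OF S(3)[OF PQ(2)] sPQ C Ccl D_def DQ] by blast
    \<comment> \<open>\<open>T\<close> meets the normalizer of \<open>D\<close> in a \<open>p\<close>-group \<open>E\<close> containing \<open>x\<close> and \<open>y\<close>, which normalizes the \<open>p\<close>-group \<open>F\<close> generated by \<open>D\<close>.\<close>
    obtain T where T: "T \<in> Syl" "x \<in> T" "y \<in> T" using pair x y by (auto simp: C_def)
    define N where "N = normalizer_in (carrier G) D"
    define E where "E = T \<inter> N"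
    have "subgroup N G" unfolding N_def using subgroup_self Dc by (rule normalizer_in_subgroup)
    then have "subgroup E G" unfolding E_def using subgroups_Inter_pair S(1)[OF T(1)] by blast
    then have Ep: "E \<in> psub (carrier G)"
      by (rule p_subgroups_subset[OF S(3)[OF T(1)]]) (auto simp: E_def)
    define F where "F = generate G D"
    have F: "F \<subseteq> P \<inter> Q" "D \<subseteq> F" "subgroup F G"
      using generate_subgroup_incl[OF _ sPQ, of D] generate.incl[of _ D G] generate_is_subgroup[OF Dc]
      by (auto simp: F_def D_def)
    then have Fp: "F \<in> psub (carrier G)" using p_subgroups_subset[OF S(3)[OF PQ(1)]] by auto
    have "E \<subseteq> normalizer_in (carrier G) F"
      using normalizer_in_le_normalizer_in_generate[OF Dc] by (auto simp: E_def N_def F_def)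
    then have "F <#> E \<in> psub (carrier G)" using psub_mult[OF Fp Ep subgroup_self] by blast
    then obtain R where R: "R \<in> Syl" "F <#> E \<subseteq> R" using p_subgroup_in_sylow by blast
    have "f \<otimes> \<one> \<in> F <#> E" if "f \<in> F" for f
      using that p_subgroupsD(4)[OF Ep] unfolding set_mult_def by blast
    then have "F \<subseteq> R" using R(2) p_subgroupsD(3)[OF Fp] by (auto simp: subset_iff)
    have "\<one> \<otimes> e \<in> F <#> E" if "e \<in> E" for e
      using that p_subgroupsD(4)[OF Fp] unfolding set_mult_def by blast
    then have "E \<subseteq> R" using R(2) p_subgroupsD(3)[OF Ep] by (auto simp: subset_iff)
    then have xyR: "x \<in> R" "y \<in> R" using x y T by (auto simp: E_def N_def)
    have "D \<subset> C \<inter> P \<inter> R" using x xyR F(2) \<open>F \<subseteq> R\<close> DP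
      by auto
    then have "C \<inter> P = C \<inter> R" by (rule max[OF PQ(1) R(1)])
    moreover have "D \<subset> C \<inter> Q \<inter> R"
      using y xyR F(2) \<open>F \<subseteq> R\<close> DQ by auto
    then have "C \<inter> Q = C \<inter> R" by (rule max[OF PQ(2) R(1)])
    ultimately show False using PQ(3) by simp
  qed
  obtain Q where "Q \<in> Syl" "u \<in> Q" using pair[of \<one> \<one>] assms(1) by auto
  then show ?thesis using eq[OF assms(3) \<open>Q \<in> Syl\<close>] uC by auto
qed

text \<open>Two subsets that each contain more than half of the Sylow subgroups intersect, so any two conjugates of
\<open>u\<close> share a Sylow subgroup.\<close>

lemma majority_of_sylows:
  assumes "u \<in> carrier G" "card Syl < 2 * card {P \<in> Syl. u \<in> P}" "P \<in> Syl"
  shows "u \<in> P"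
proof (rule baer_suzuki[OF assms(1) _ assms(3)])
  fix g h assume gh: "g \<in> carrier G" "h \<in> carrier G"
  let ?A = "{P \<in> Syl. conjugate g u \<in> P}" and ?B = "{P \<in> Syl. conjugate h u \<in> P}"
  have "card (?A \<union> ?B) + card (?A \<inter> ?B) = card ?A + card ?B"
    by (rule card_Un_Int[symmetric]) (auto simp: finite_sylows)
  also have "\<dots> = 2 * card {P \<in> Syl. u \<in> P}"
    using card_sylows_containing_conjugate[OF assms(1)] gh by simp
  finally have "card (?A \<union> ?B) + card (?A \<inter> ?B) > card Syl" using assms(2) by simp
  moreover have "card (?A \<union> ?B) \<le> card Syl"
    by (rule card_mono) (auto simp: finite_sylows)
  ultimately have "card (?A \<inter> ?B) \<noteq> 0" by linarith
  then have "?A \<inter> ?B \<noteq> {}" by (metis card.empty)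
  then show "\<exists>P\<in>Syl. conjugate g u \<in> P \<and> conjugate h u \<in> P" by blast
qed

text \<open>The proportion of Sylow subgroups through \<open>u\<close> is at most one half, and not exactly one half, since \<open>2 * l\<close>
and \<open>l\<close> cannot both be \<open>1\<close> modulo \<open>p\<close>.  The resulting gap is at least the order of the normalizer of a Sylow
subgroup through \<open>u\<close>, which contains \<open>\<one>\<close> and \<open>u\<close>.\<close>

lemma card_subnormalizer_le:
  assumes "u \<in> carrier G" "u [^] (p ^ k) = \<one>" and "S \<in> Syl" "u \<notin> S"
  shows "2 * card (subnormalizer (carrier G) {u}) + 2 \<le> order G"
proof -
  define n where "n = card Syl"
  define l where "l = card {P \<in> Syl. u \<in> P}"
  have gen: "generate G {u} \<in> psub (carrier G)"
    by (rule generate_psub[OF subgroup_self assms(1,2)])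
  have gen_iff: "generate G {u} \<subseteq> P \<longleftrightarrow> u \<in> P" if "P \<in> Syl"
    for P
    using generate_subgroup_incl[of "{u}" P] p_subgroupsD(1)[OF sylowsD[OF that]] generate.incl[of u "{u}" G]
    by auto
  have "{P \<in> Syl. generate G {u} \<subseteq> P} = {P \<in> Syl. u \<in> P}" using gen_iff
    by blast
  then have l1: "l mod p = 1" using card_sylows_containing[OF subgroup_self gen]
    by (simp add: l_def)
  have "{P \<in> Syl. {\<one>} \<subseteq> P} = Syl" using p_subgroupsD(4) sylowsD by blast
  then have n1: "n mod p = 1"
    using card_sylows_containing[OF subgroup_self one_p_subgroup[OF subgroup_self]]
      by (simp add: n_def)
  have "2 * l \<le> n" using majority_of_sylows[OF assms(1) _ assms(3)] assms(4)
    by (force simp: n_def l_def)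
  moreover have "2 * l \<noteq> n"
  proof
    assume "2 * l = n"
    then have "(l + l) mod p = l mod p" using l1 n1 by (simp add: mult_2)
    then have "p dvd l" by (metis add_diff_cancel_left' dvd_minus_mod mod_eq_dvd_iff_nat le_add1)
    then show False using l1 by simp
  qed
  ultimately have ln: "2 * l + 1 \<le> n" by linarith
  obtain P where P: "P \<in> Syl" "u \<in> P" using p_subgroup_in_sylow[OF gen] gen_iff by blast
  note Pp = p_subgroupsD[OF sylowsD[OF P(1)]]
  have "u \<noteq> \<one>" using assms(3,4) p_subgroupsD(4) sylowsD by blast
  then have "card {\<one>, u} = 2" by simp
  moreover have "{\<one>, u} \<subseteq> normalizer_in (carrier G) P"
    using P(2) Pp(4) subgroup_le_normalizer_in[OF Pp(1,3)] by auto
  moreover have "finite (normalizer_in (carrier G) P)" using fin normalizer_in_subset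
    by (rule finite_subset[rotated])
  ultimately have c2: "2 \<le> card (normalizer_in (carrier G) P)" by (metis card_mono)
  have "{P' \<in> Syl. {u} \<subseteq> P'} = {P \<in> Syl. u \<in> P}" by auto
  then have "card (subnormalizer (carrier G) {u}) = l * card (normalizer_in (carrier G) P)"
    using card_subnormalizer_eq[OF subgroup_self P(1), of "{u}"] by (simp add: l_def)
  then have "2 * card (subnormalizer (carrier G) {u}) + 2 \<le> (2 * l + 1) * card (normalizer_in (carrier G) P)"
    using c2 by simp
  also have "\<dots> \<le> n * card (normalizer_in (carrier G) P)" using ln by (rule mult_le_mono1)
  also have "\<dots> = order G" using card_sylows_times_normalizer[OF subgroup_self P(1)]
    by (simp add: n_def order_def)
  finally show ?thesis .
qed

end

section \<open>The lower central series\<close>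

context group
begin

lemma commutator_conj:
  assumes "g \<in> carrier G" "h \<in> carrier G" "k \<in> carrier G"
  shows "g \<otimes> (h \<otimes> k \<otimes> inv h \<otimes> inv k) \<otimes> inv g
    = (g \<otimes> h \<otimes> inv g) \<otimes> (g \<otimes> k \<otimes> inv g) \<otimes> inv (g \<otimes> h \<otimes> inv g) \<otimes> inv (g \<otimes> k \<otimes> inv g)"
proof -
  have cancel: "inv g \<otimes> (g \<otimes> z) = z" if "z \<in> carrier G" for z
    using assms that by (simp add: m_assoc[symmetric])
  show ?thesis using assms by (simp add: m_assoc inv_mult_group cancel)
qed

lemma lcs_carrier: "lower_central_series G n \<subseteq> carrier G"
proof (induction n)
  case (Suc n)
  then show ?case
    unfolding lower_central_series.simps commutator_subgroup_def by (intro generate_incl) auto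
qed simp

lemma lcs_commutator:
  assumes "g \<in> lower_central_series G n" "h \<in> carrier G"
  shows "g \<otimes> h \<otimes> inv g \<otimes> inv h \<in> lower_central_series G (Suc n)"
  unfolding lower_central_series.simps commutator_subgroup_def using assms
    by (intro generate.incl) blast

lemma lcs_normal: "lower_central_series G n \<lhd> G"
proof (induction n)
  case 0
  then show ?case using normal_self by simp
next
  case (Suc n)
  let ?L = "lower_central_series G n"
  show ?case
    unfolding lower_central_series.simps commutator_subgroup_def
  proof (rule normal_generateI)
    show "(\<Union>h\<in>?L. \<Union>k\<in>carrier G. {h \<otimes> k \<otimes> inv h \<otimes> inv k}) \<subseteq> carrier G"
      using lcs_carrier[of n] by auto
    fix x g assume "x \<in> (\<Union>h\<in>?L. \<Union>k\<in>carrier G. {h \<otimes> k \<otimes> inv h \<otimes> inv k})" and g: "g \<in> carrier G"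
    then obtain h k where hk: "h \<in> ?L" "k \<in> carrier G" "x = h \<otimes> k \<otimes> inv h \<otimes> inv k" by auto
    have "g \<otimes> x \<otimes> inv g = (g \<otimes> h \<otimes> inv g) \<otimes> (g \<otimes> k \<otimes> inv g) \<otimes> inv (g \<otimes> h \<otimes> inv g) \<otimes> inv (g \<otimes> k \<otimes> inv g)"
      unfolding hk(3) using g hk(1,2) lcs_carrier[of n] by (intro commutator_conj) auto
    moreover have "g \<otimes> h \<otimes> inv g \<in> ?L" using Suc hk(1) g
      by (simp add: normal_inv_iff)
    moreover have "g \<otimes> k \<otimes> inv g \<in> carrier G" using g hk by simp
    ultimately show "g \<otimes> x \<otimes> inv g \<in> (\<Union>h\<in>?L. \<Union>k\<in>carrier G. {h \<otimes> k \<otimes> inv h \<otimes> inv k})" by blast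
  qed
qed

lemma lcs_decreasing: "lower_central_series G (Suc n) \<subseteq> lower_central_series G n"
proof -
  let ?L = "lower_central_series G n"
  have L: "subgroup ?L G" using lcs_normal normal_imp_subgroup by blast
  show ?thesis
    unfolding lower_central_series.simps commutator_subgroup_def
  proof (rule generate_subgroup_incl[OF _ L])
    show "(\<Union>h\<in>?L. \<Union>k\<in>carrier G. {h \<otimes> k \<otimes> inv h \<otimes> inv k}) \<subseteq> ?L"
    proof clarify
      fix h k assume hk: "h \<in> ?L" "k \<in> carrier G"
      have "k \<otimes> inv h \<otimes> inv k \<in> ?L"
        using lcs_normal[of n] L hk by (simp add: normal_inv_iff subgroup.m_inv_closed)
      then have "h \<otimes> (k \<otimes> inv h \<otimes> inv k) \<in> ?L" using L hk
        by (simp add: subgroup.m_closed)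
      then show "h \<otimes> k \<otimes> inv h \<otimes> inv k \<in> ?L" using hk lcs_carrier[of n]
        by (simp add: m_assoc subset_iff)
    qed
  qed
qed

end

context finite_group
begin

lemma normal_conjugate: "H \<lhd> G \<Longrightarrow> g \<in> carrier G \<Longrightarrow> h \<in> H \<Longrightarrow> conjugate g h \<in> H"
  by (simp add: conjugate_def normal_inv_iff)

lemma normalI_conjugate: "subgroup H G \<Longrightarrow> (\<And>g h. g \<in> carrier G \<Longrightarrow> h \<in> H \<Longrightarrow> conjugate g h \<in> H) \<Longrightarrow> H \<lhd> G"
  by (simp add: conjugate_def normal_inv_iff)

text \<open>The properties of the lower central series of \<open>K\<close> behind the normalizer condition, stated inside the
ambient group to keep its multiplication and inverse.\<close>

definition central_chain :: "'a set \<Rightarrow> (nat \<Rightarrow> 'a set) \<Rightarrow> bool"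
  where "central_chain K \<gamma> \<longleftrightarrow> \<gamma> 0 = K \<and> (\<forall>i. \<gamma> i \<subseteq> K) \<and>
    (\<forall>i. \<forall>g\<in>\<gamma> i. \<forall>h\<in>K. g \<otimes> h \<otimes> inv g \<otimes> inv h \<in> \<gamma> (Suc i))"

lemma central_chain_lcs:
  assumes "subgroup K G"
  shows "central_chain K (lower_central_series (G\<lparr>carrier := K\<rparr>))"
proof -
  interpret K: group "G\<lparr>carrier := K\<rparr>" using subgroup_imp_group[OF assms] .
  let ?L = "lower_central_series (G\<lparr>carrier := K\<rparr>)"
  have sub: "?L i \<subseteq> K" for i using K.lcs_carrier[of i] by simp
  have "g \<otimes> h \<otimes> inv g \<otimes> inv h \<in> ?L (Suc i)"
    if "g \<in> ?L i" "h \<in> K" for g h i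
  proof -
    have "g \<in> K" using sub that(1) by blast
    then show ?thesis
      using K.lcs_commutator[of g i h] that m_inv_consistent[OF assms]
      by (simp del: lower_central_series.simps)
  qed
  then show ?thesis unfolding central_chain_def using sub by simp
qed

lemma normalizer_condition:
  assumes "central_chain K \<gamma>" "subgroup K G" "subgroup H G" "H \<subset> K" "\<gamma> n \<subseteq> H"
  shows "\<exists>g \<in> K. g \<notin> H \<and> g \<in> normalizer_in K H"
proof -
  define i where "i = (LEAST i. \<gamma> i \<subseteq> H)"
  have i: "\<gamma> i \<subseteq> H" unfolding i_def using assms(5) by (rule LeastI)
  have "i \<noteq> 0" using i assms(1,4) by (auto simp: central_chain_def intro!: Nat.gr0I)
  then obtain j where j: "i = Suc j" using not0_implies_Suc by blast
  then have "\<not> \<gamma> j \<subseteq> H" unfolding i_def by (metis not_less_Least lessI)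
  then obtain g where g: "g \<in> \<gamma> j" "g \<notin> H" by auto
  have gK: "g \<in> K" using g assms(1) by (auto simp: central_chain_def)
  then have gc: "g \<in> carrier G" using assms(2) subgroup.mem_carrier by metis
  have "g \<in> normalizer_in K H"
  proof (rule normalizer_inI[OF assms(2) subgroup.subset[OF assms(3)] gK])
    fix h assume h: "h \<in> H"
    then have hc: "h \<in> carrier G" "h \<in> K" using assms(3,4) subgroup.mem_carrier
      by (metis, auto)
    have "g \<otimes> h \<otimes> inv g \<otimes> inv h \<in> H"
      using assms(1) g(1) hc(2) i unfolding central_chain_def j by blast
    then have "(g \<otimes> h \<otimes> inv g \<otimes> inv h) \<otimes> h \<in> H" using h assms(3)
      by (simp add: subgroup.m_closed)
    then show "conjugate g h \<in> H" using gc hc by (simp add: m_assoc conjugate_def)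
  qed
  with g gK show ?thesis by blast
qed

end

context finite_group_at_prime
begin

lemma syl_mono:
  assumes "P \<in> syl K" "P \<subseteq> H" "H \<subseteq> K"
  shows "P \<in> syl H"
proof -
  have "Q \<in> psub K" if "Q \<in> psub H" for Q
    using p_subgroups_mono[OF that, of K] p_subgroupsD(2)[OF that] assms(3) by simp
  moreover have "P \<in> psub H" using p_subgroups_mono[OF sylowsD[OF assms(1)] assms(2)] .
  ultimately show ?thesis using assms(1) by (simp add: sylows_def)
qed

text \<open>If \<open>K/R\<close> is nilpotent, \<open>R\<close> supplements every Sylow normalizer.  The subgroup \<open>H\<close> generated by \<open>R\<close> and
the normalizer of \<open>T\<close> is self-normalizing: if \<open>g\<close> normalizes it, then \<open>T\<close> and its conjugate by \<open>g\<close> are Sylow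
in \<open>H\<close>, hence conjugate in \<open>H\<close>.  The normalizer condition then forces \<open>H = K\<close>.\<close>

lemma frattini_nilpotent_quotient:
  assumes "central_chain K \<gamma>" "subgroup K G" "subgroup R G" "R \<subseteq> K" "K \<subseteq> normalizer_in (carrier G) R" "\<gamma> n \<subseteq> R"
    and T: "T \<in> syl K"
  shows "R <#> normalizer_in K T = K"
proof (rule ccontr)
  note Tp = p_subgroupsD[OF sylowsD[OF T]]
  define H where "H = R <#> normalizer_in K T"
  assume "R <#> normalizer_in K T \<noteq> K"
  have M: "subgroup (normalizer_in K T) G" "normalizer_in K T \<subseteq> K"
    using normalizer_in_subgroup[OF assms(2) Tp(3)] normalizer_in_subset by auto
  have H: "subgroup H G" unfolding H_def
    by (rule subgroup_mult_of_normalizer_in[OF assms(3) M(1)]) (use M(2) assms(5) in auto)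
  have "H \<subseteq> K" unfolding H_def set_mult_def using assms(2,4) M(2) subgroup.m_closed
    by fastforce
  then have HK: "H \<subset> K" using \<open>R <#> normalizer_in K T \<noteq> K\<close>
    by (auto simp: H_def)
  have "r \<otimes> \<one> \<in> H" if "r \<in> R" for r
    using that subgroup.one_closed[OF M(1)] unfolding H_def set_mult_def by blast
  then have RH: "R \<subseteq> H" using subgroup.mem_carrier[OF assms(3)] by (metis r_one subsetI)
  have "\<one> \<otimes> m \<in> H" if "m \<in> normalizer_in K T" for m
    using that subgroup.one_closed[OF assms(3)] unfolding H_def set_mult_def by blast
  then have MH: "normalizer_in K T \<subseteq> H" using subgroup.mem_carrier[OF M(1)]
    by (metis l_one subsetI)
  obtain g where g: "g \<in> K" "g \<notin> H" "g \<in> normalizer_in K H"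
    using normalizer_condition[OF assms(1,2) H HK, of n] assms(6) RH by blast
  have gc: "g \<in> carrier G" using g assms(2) subgroup.mem_carrier by metis
  have TH: "T \<subseteq> H" using subgroup_le_normalizer_in[OF Tp(1,2)] MH by auto
  have T1: "T \<in> syl H" using syl_mono[OF T TH \<open>H \<subseteq> K\<close>] .
  have "conjugate g ` T \<subseteq> H" using normalizer_in_conjugate[OF g(3)] TH by auto
  then have T2: "conjugate g ` T \<in> syl H"
    using syl_mono[OF conjugate_sylow[OF assms(2) g(1) T] _ \<open>H \<subseteq> K\<close>] by blast
  then obtain h where h: "h \<in> H" "conjugate g ` T = conjugate h ` T"
    using sylows_conjugate[OF H T1] by auto
  have hc: "h \<in> carrier G" "inv h \<in> carrier G" "h \<in> K"
    using h H \<open>H \<subseteq> K\<close> subgroup.mem_carrier by (metis, metis inv_closed, auto)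
  have "conjugate (inv h \<otimes> g) ` T = conjugate (inv h) ` (conjugate g ` T)" using hc gc Tp(3)
    by (intro conjugate_image_comp) auto
  also have "\<dots> = T" unfolding h(2) using hc Tp(3) by simp
  finally have "inv h \<otimes> g \<in> normalizer_in K T"
    using hc g(1) assms(2) by (simp add: normalizer_in_def subgroup.m_closed subgroup.m_inv_closed)
  then have "h \<otimes> (inv h \<otimes> g) \<in> H" using MH h(1) H
    by (auto intro: subgroup.m_closed)
  then have "g \<in> H" using hc gc by (simp add: m_assoc[symmetric])
  with g show False by simp
qed

text \<open>The case \<open>R = 1\<close> of the Frattini argument.\<close>

lemma nilpotent_sylow_normal:
  assumes "subgroup K G" "nilpotent (G\<lparr>carrier := K\<rparr>)" "T \<in> syl K"
  shows "normalizer_in K T = K"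
proof -
  obtain n where n: "lower_central_series (G\<lparr>carrier := K\<rparr>) n = {\<one>}"
    using assms(2) by (auto simp: nilpotent_def)
  have Kc: "K \<subseteq> carrier G" using subgroup.subset[OF assms(1)] .
  have "{\<one>} <#> normalizer_in K T = K"
  proof (rule frattini_nilpotent_quotient[OF central_chain_lcs[OF assms(1)] assms(1) triv_subgroup _ _ _ assms(3)])
    show "{\<one>} \<subseteq> K" using assms(1) subgroup.one_closed by auto
    show "K \<subseteq> normalizer_in (carrier G) {\<one>}" using Kc
      by (auto simp: normalizer_in_def subset_iff)
    show "lower_central_series (G\<lparr>carrier := K\<rparr>) n \<subseteq> {\<one>}" using n
      by simp
  qed
  moreover have "{\<one>} <#> normalizer_in K T = normalizer_in K T"
    using normalizer_in_subset[of K T] Kc by (force simp: set_mult_def)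
  ultimately show ?thesis by simp
qed

lemma sylow_containing:
  assumes "subgroup K G" "u \<in> K" "u [^] (p ^ k) = \<one>"
  shows "\<exists>T \<in> syl K. u \<in> T"
  using p_subgroup_in_sylow[OF generate_psub[OF assms]] generate.incl[of u "{u}" G] by blast

lemma nilpotent_in_subnormalizer:
  assumes "subgroup K G" "nilpotent (G\<lparr>carrier := K\<rparr>)" "u \<in> K" "u [^] (p ^ k) = \<one>" "y \<in> K"
  shows "y \<in> subnormalizer (carrier G) {u}"
proof -
  obtain T where T: "T \<in> syl K" "u \<in> T" using sylow_containing[OF assms(1,3,4)] by blast
  have "y \<in> normalizer_in K T" using nilpotent_sylow_normal[OF assms(1,2) T(1)] assms(5) by simp
  moreover have Kc: "K \<subseteq> carrier G" using subgroup.subset[OF assms(1)] .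
  moreover have "T \<in> psub (carrier G)"
    using p_subgroups_mono[OF sylowsD[OF T(1)]] p_subgroupsD(3)[OF sylowsD[OF T(1)]] by blast
  ultimately show ?thesis using T(2)
    by (auto simp: subnormalizer_def invariant_p_subgroups_def normalizer_in_def)
qed

end

context finite_group
begin

text \<open>The least positive exponent \<open>k\<close> with \<open>y [^] k \<in> C\<close> divides all others.  For every prime \<open>q\<close> the part of
\<open>ord y\<close> prime to \<open>q\<close> is such an exponent, so no prime divides \<open>k\<close>.\<close>

lemma mem_of_prime_power_parts:
  assumes "y \<in> carrier G" "subgroup C G"
    and pp: "\<And>q m k. Factorial_Ring.prime (q::nat) \<Longrightarrow> (y [^] m) [^] (q ^ k) = \<one> \<Longrightarrow> y [^] (m::nat) \<in> C"
  shows "y \<in> C"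
proof -
  define k :: nat where "k = (LEAST k. k > 0 \<and> y [^] k \<in> C)"
  have ord: "ord y > 0 \<and> y [^] ord y \<in> C"
    using ord_ge_1[OF fin assms(1)] assms(1,2) by (simp add: subgroup.one_closed)
  then have k: "k > 0 \<and> y [^] k \<in> C" unfolding k_def by (rule LeastI)
  have dvd: "k dvd j" if "y [^] j \<in> C" for j
  proof (rule ccontr)
    assume "\<not> k dvd j"
    then have r: "0 < j mod k" "j mod k < k" using k by (auto simp: dvd_eq_mod_eq_0)
    define a where "a = (y [^] k) [^] (j div k)"
    have a: "a \<in> C" unfolding a_def using k assms(2) subgroup_nat_pow by blast
    have ac: "a \<in> carrier G" using assms(1) by (simp add: a_def)
    have "y [^] j = a \<otimes> y [^] (j mod k)"
      using assms(1) by (simp add: a_def nat_pow_pow nat_pow_mult)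
    then have "y [^] (j mod k) = inv a \<otimes> y [^] j" using ac assms(1)
      by (simp add: m_assoc[symmetric])
    then have "y [^] (j mod k) \<in> C" using a that assms(2)
      by (simp add: subgroup.m_closed subgroup.m_inv_closed)
    with r(1) have "(LEAST k. k > 0 \<and> y [^] k \<in> C) \<le> j mod k" by (intro Least_le) simp
    then have "k \<le> j mod k" by (simp only: k_def[symmetric])
    then show False using r by simp
  qed
  have "k = 1"
  proof (rule ccontr)
    assume "k \<noteq> 1"
    then obtain q where q: "Factorial_Ring.prime q" "q dvd k" using prime_factor_nat by blast
    have "ord y \<noteq> 0" using ord by simp
    moreover have "\<not> is_unit q" using q(1) not_prime_unit by blast
    ultimately obtain m where m: "ord y = q ^ multiplicity q (ord y) * m" "\<not> q dvd m"
      using multiplicity_decompose'[of "ord y" q] by metis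
    have "(y [^] m) [^] (q ^ multiplicity q (ord y)) = \<one>"
      using assms(1) m(1) by (metis nat_pow_pow mult.commute pow_ord_eq_1)
    then have "y [^] m \<in> C" by (rule pp[OF q(1)])
    then have "k dvd m" by (rule dvd)
    then show False using q(2) m(2) dvd_trans by blast
  qed
  then show ?thesis using k assms(1) by simp
qed

lemma card_proper_subgroup:
  assumes "subgroup H G" "H \<noteq> carrier G"
  shows "2 * card H \<le> order G"
proof -
  have l: "card (rcosets H) * card H = order G" by (rule lagrange[OF assms(1)])
  have pos: "order G > 0" using fin by (simp add: order_gt_0_iff_finite)
  have "card (rcosets H) \<noteq> 1"
  proof
    assume "card (rcosets H) = 1"
    then have "card H = card (carrier G)" using l by (simp add: order_def)
    then show False using assms(2) fin subgroup.subset[OF assms(1)] card_subset_eq by blast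
  qed
  moreover have "card (rcosets H) \<noteq> 0" using l pos by (metis mult_0 less_not_refl)
  ultimately have "2 \<le> card (rcosets H)" by simp
  then show ?thesis using l by (metis mult_le_mono1)
qed

definition centralizer :: "'a set \<Rightarrow> 'a set"
  where "centralizer A = {g \<in> carrier G. \<forall>a\<in>A. g \<otimes> a = a \<otimes> g}"

lemma centralizer_conjugate: "A \<subseteq> carrier G \<Longrightarrow> g \<in> centralizer A \<longleftrightarrow> g \<in> carrier G \<and> (\<forall>a\<in>A. conjugate g a = a)"
  by (auto simp: centralizer_def conjugate_eq_iff subset_iff)

lemma subgroup_centralizer:
  assumes "A \<subseteq> carrier G"
  shows "subgroup (centralizer A) G"
proof (rule subgroupI)
  show "centralizer A \<subseteq> carrier G" by (auto simp: centralizer_def)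
  have "\<one> \<in> centralizer A" using assms by (auto simp: centralizer_conjugate)
  then show "centralizer A \<noteq> {}" by blast
  show "inv a \<in> centralizer A" if a: "a \<in> centralizer A" for a
  proof -
    have ac: "a \<in> carrier G" "\<And>x. x \<in> A \<Longrightarrow> conjugate a x = x"
      using a assms by (auto simp: centralizer_conjugate)
    have "conjugate (inv a) x = x" if "x \<in> A" for x
      using ac(2)[OF that] conjugate_inv(1)[OF ac(1), of x] that assms by (simp add: subset_iff)
    then show ?thesis using ac(1) assms by (simp add: centralizer_conjugate)
  qed
  show "a \<otimes> b \<in> centralizer A" if "a \<in> centralizer A" "b \<in> centralizer A"
    for a b
    using that assms by (auto simp: centralizer_conjugate conjugate_comp subset_iff)
qed

lemma centralizer_normal:
  assumes "A \<lhd> G"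
  shows "centralizer A \<lhd> G"
proof -
  have Ac: "A \<subseteq> carrier G" using assms normal_imp_subgroup subgroup.subset by blast
  show ?thesis
  proof (rule normalI_conjugate[OF subgroup_centralizer[OF Ac]])
    fix g h assume g: "g \<in> carrier G" and h: "h \<in> centralizer A"
    have "conjugate (conjugate g h) a = a" if a: "a \<in> A" for a
    proof -
      have hc: "h \<in> carrier G" "a \<in> carrier G" using h a Ac by (auto simp: centralizer_def)
      have "conjugate (conjugate g h) a = conjugate g (conjugate h (conjugate (inv g) a))"
        using g hc by (simp add: conjugate_def inv_mult_group m_assoc)
      also have "conjugate h (conjugate (inv g) a) = conjugate (inv g) a"
        using h normal_conjugate[OF assms _ a, of "inv g"] g Ac by (simp add: centralizer_conjugate)
      finally show ?thesis using g hc by simp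
    qed
    then show "conjugate g h \<in> centralizer A" using g h Ac by (simp add: centralizer_conjugate)
  qed
qed

definition nil_partners :: "'a \<Rightarrow> 'a set"
  where "nil_partners x = {y \<in> carrier G. nilpotent (G\<lparr>carrier := generate G {x, y}\<rparr>)}"

lemma dn_eq: "dn G = real (\<Sum>x\<in>carrier G. card (nil_partners x)) / (real (order G))\<^sup>2"
proof -
  have "{(x, y) \<in> carrier G \<times> carrier G. nilpotent (G\<lparr>carrier := generate G {x, y}\<rparr>)} = Sigma (carrier G) nil_partners"
    by (auto simp: nil_partners_def)
  moreover have "card (Sigma (carrier G) nil_partners) = (\<Sum>x\<in>carrier G. card (nil_partners x))"
    using fin by (intro card_SigmaI) (auto simp: nil_partners_def)
  ultimately show ?thesis by (simp add: dn_def)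
qed

text \<open>The identity exceeds the average \<open>order G / 2\<close> by \<open>order G / 2\<close>; the elements outside \<open>S\<close> fall short of it
by at least \<open>1\<close> each, and there are at least \<open>order G / 2\<close> of them.\<close>

lemma dn_le_half:
  assumes "S \<subseteq> carrier G" "\<one> \<in> S" "2 * card S \<le> order G"
    and S: "\<And>x. x \<in> S \<Longrightarrow> x \<noteq> \<one> \<Longrightarrow> 2 * card (nil_partners x) \<le> order G"
    and out: "\<And>x. x \<in> carrier G \<Longrightarrow> x \<notin> S \<Longrightarrow> 2 * card (nil_partners x) + 2 \<le> order G"
  shows "dn G \<le> 1 / 2"
proof -
  define n where "n = order G"
  have finS: "finite S" using assms(1) fin by (rule finite_subset)
  have npos: "n > 0" using fin by (simp add: n_def order_gt_0_iff_finite)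
  have Spos: "card S > 0" using finS assms(2) by (auto simp: card_gt_0_iff)
  have n_S: "card (carrier G - S) = n - card S" using assms(1) finS
    by (simp add: card_Diff_subset n_def order_def)
  have "card S \<le> n" using assms(3) by (simp add: n_def)
  have nil_le: "card (nil_partners x) \<le> n" for x unfolding n_def order_def using fin
    by (intro card_mono) (auto simp: nil_partners_def)
  have "(\<Sum>x\<in>carrier G. 2 * int (card (nil_partners x))) = (\<Sum>x\<in>S. 2 * int (card (nil_partners x))) + (\<Sum>x\<in>carrier G - S. 2 * int (card (nil_partners x)))"
    using assms(1) fin by (simp add: sum.subset_diff add.commute)
  also have "(\<Sum>x\<in>S. 2 * int (card (nil_partners x))) = 2 * int (card (nil_partners \<one>)) + (\<Sum>x\<in>S - {\<one>}. 2 * int (card (nil_partners x)))"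
    using finS assms(2) by (simp add: sum.remove)
  also have "(\<Sum>x\<in>S - {\<one>}. 2 * int (card (nil_partners x))) \<le> (\<Sum>x\<in>S - {\<one>}. int n)"
  proof (rule sum_mono)
    fix x assume "x \<in> S - {\<one>}"
    then show "2 * int (card (nil_partners x)) \<le> int n" using S[of x] by (simp add: n_def)
  qed
  also have "(\<Sum>x\<in>carrier G - S. 2 * int (card (nil_partners x))) \<le> (\<Sum>x\<in>carrier G - S. int n - 2)"
  proof (rule sum_mono)
    fix x assume "x \<in> carrier G - S"
    then show "2 * int (card (nil_partners x)) \<le> int n - 2" using out[of x] by (simp add: n_def)
  qed
  also have "(\<Sum>x\<in>S - {\<one>}. int n) = (int (card S) - 1) * int n"
    using finS assms(2) Spos by (simp add: card_Diff_singleton of_nat_diff)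
  also have "(\<Sum>x\<in>carrier G - S. int n - 2) = (int n - int (card S)) * (int n - 2)"
    using n_S \<open>card S \<le> n\<close> by (simp add: of_nat_diff)
  also have "2 * int (card (nil_partners \<one>)) \<le> 2 * int n" using nil_le[of \<one>] by simp
  also have "2 * int n + (int (card S) - 1) * int n + (int n - int (card S)) * (int n - 2) = int n * int n - int n + 2 * int (card S)"
    by (simp add: algebra_simps)
  also have "\<dots> \<le> int n * int n" using assms(3) by (simp add: n_def)
  finally have "(\<Sum>x\<in>carrier G. 2 * int (card (nil_partners x))) \<le> int (n * n)" by simp
  then have "int (2 * (\<Sum>x\<in>carrier G. card (nil_partners x))) \<le> int (n * n)"
    by (simp add: sum_distrib_left)
  then have "2 * (\<Sum>x\<in>carrier G. card (nil_partners x)) \<le> n * n" by linarith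
  then have "2 * real (\<Sum>x\<in>carrier G. card (nil_partners x)) \<le> (real n)\<^sup>2"
    unfolding power2_eq_square by (metis of_nat_le_iff of_nat_mult of_nat_numeral)
  then show ?thesis unfolding dn_eq using npos by (simp add: n_def[symmetric] divide_le_eq)
qed

end

section \<open>Cores and centralizers\<close>

context finite_group_at_prime
begin

lemma p_power_ord:
  assumes "x \<in> carrier G" "\<nexists>k. x [^] (p ^ k) = \<one>"
  shows "\<exists>q. Factorial_Ring.prime q \<and> q \<noteq> p \<and> q dvd ord x"
proof -
  have "ord x > 0" using ord_ge_1[OF fin assms(1)] by simp
  moreover have "\<not> is_unit p" using prime_p not_prime_unit by blast
  ultimately obtain m where m: "ord x = p ^ multiplicity p (ord x) * m" "\<not> p dvd m"
    using multiplicity_decompose'[of "ord x" p] by (metis less_not_refl)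
  have "m \<noteq> 1"
  proof
    assume "m = 1"
    then have "ord x = p ^ multiplicity p (ord x)" using m(1) by simp
    then have "x [^] (p ^ multiplicity p (ord x)) = \<one>" using pow_ord_eq_1[OF assms(1)] by metis
    then show False using assms(2) by blast
  qed
  then obtain q where q: "Factorial_Ring.prime q" "q dvd m" using prime_factor_nat by blast
  then have "q \<noteq> p" using m(2) by auto
  moreover have "q dvd ord x" using q(2) by (subst m(1)) simp
  ultimately show ?thesis using q(1) by blast
qed

lemma ex_power_of_order_p:
  assumes "x \<in> carrier G" "p dvd ord x"
  shows "\<exists>m. x [^] (m::nat) \<noteq> \<one> \<and> (x [^] m) [^] (p ^ 1) = \<one>"
proof -
  have ord: "ord x > 0" using ord_ge_1[OF fin assms(1)] by simp
  obtain m where m: "ord x = p * m" using assms(2) by (elim dvdE)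
  have "0 < m" "m < ord x" using m ord prime_gt_1_nat[OF prime_p] by auto
  then have "x [^] m \<noteq> \<one>" using assms(1) by (auto simp: pow_eq_id dest: dvd_imp_le)
  moreover have "(x [^] m) [^] (p ^ 1) = \<one>"
    using assms(1) pow_ord_eq_1[OF assms(1)] m by (simp add: nat_pow_pow mult.commute)
  ultimately show ?thesis by blast
qed

text \<open>Nilpotent partners of \<open>x\<close> are nilpotent partners of its power of order \<open>p\<close>, which lies outside the trivial
core.\<close>

lemma card_nil_partners_le_of_trivial_core:
  assumes "x \<in> carrier G" "p dvd ord x" "\<Inter>Syl = {\<one>}"
  shows "2 * card (nil_partners x) + 2 \<le> order G"
proof -
  obtain m :: nat where m: "x [^] m \<noteq> \<one>" "(x [^] m) [^] (p ^ 1) = \<one>"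
    using ex_power_of_order_p[OF assms(1,2)] by blast
  obtain S where S: "S \<in> Syl" "x [^] m \<notin> S" using m(1) assms(3) by blast
  have "nil_partners x \<subseteq> subnormalizer (carrier G) {x [^] m}"
  proof
    fix y assume "y \<in> nil_partners x"
    then have y: "y \<in> carrier G" "nilpotent (G\<lparr>carrier := generate G {x, y}\<rparr>)"
      by (auto simp: nil_partners_def)
    have K: "subgroup (generate G {x, y}) G" using y(1) assms(1)
      by (intro generate_is_subgroup) auto
    have "x \<in> generate G {x, y}" "y \<in> generate G {x, y}" by (auto intro: generate.incl)
    then show "y \<in> subnormalizer (carrier G) {x [^] m}"
      using nilpotent_in_subnormalizer[OF K y(2) _ m(2)] subgroup_nat_pow[OF K] by blast
  qed
  then have "card (nil_partners x) \<le> card (subnormalizer (carrier G) {x [^] m})"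
    using fin by (intro card_mono) (auto simp: subnormalizer_def)
  moreover have "2 * card (subnormalizer (carrier G) {x [^] m}) + 2 \<le> order G"
    using card_subnormalizer_le[OF nat_pow_closed[OF assms(1)] m(2) S] .
  ultimately show ?thesis by linarith
qed

lemma core_normal: "\<Inter>Syl \<lhd> G"
proof (rule normalI_conjugate)
  obtain P where "P \<in> Syl" using ex_sylow[OF subgroup_self] by blast
  then show "subgroup (\<Inter>Syl) G" using p_subgroupsD(1)[OF sylowsD]
    by (intro subgroups_Inter) auto
  fix g h assume g: "g \<in> carrier G" and h: "h \<in> \<Inter>Syl"
  show "conjugate g h \<in> \<Inter>Syl"
  proof
    fix P assume P: "P \<in> Syl"
    have "conjugate (inv g) ` P \<in> Syl" using conjugate_sylow[OF subgroup_self _ P] g by auto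
    then obtain z where z: "z \<in> P" "h = conjugate (inv g) z" using h by auto
    have "z \<in> carrier G" using p_subgroupsD(3)[OF sylowsD[OF P]] z by auto
    then show "conjugate g h \<in> P" using z g by simp
  qed
qed

lemma core_psub: "\<Inter>Syl \<in> psub (carrier G)"
proof -
  obtain P where P: "P \<in> Syl" using ex_sylow[OF subgroup_self] by blast
  show ?thesis
    by (rule p_subgroups_subset[OF sylowsD[OF P] normal_imp_subgroup[OF core_normal]]) (use P in auto)
qed

lemma p_and_q_element:
  assumes "Factorial_Ring.prime q" "q \<noteq> p" "x \<in> carrier G" "x [^] (p ^ k) = \<one>" "x [^] (q ^ j) = \<one>"
  shows "x = \<one>"
proof -
  have "ord x dvd q ^ j" "ord x dvd p ^ k" using assms by (simp_all add: pow_eq_id)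
  moreover have "coprime (q ^ j) (p ^ k)" using assms(1,2) prime_p by (simp add: primes_coprime)
  ultimately have "ord x = 1" using coprime_common_divisor_nat by blast
  then show ?thesis using assms(3) ord_eq_1 by blast
qed

text \<open>\<open>Q\<close> acts on \<open>R\<close> by conjugation; the number of fixed points is divisible by \<open>p\<close>, and \<open>\<one>\<close> is one of them.\<close>

lemma normal_psub_meets_center:
  assumes "Q \<in> psub (carrier G)" "R \<lhd> G" "R \<in> psub (carrier G)" "R \<noteq> {\<one>}"
  shows "centralizer Q \<inter> R \<noteq> {\<one>}"
proof
  assume triv: "centralizer Q \<inter> R = {\<one>}"
  note R = p_subgroupsD[OF assms(3)] and Q = p_subgroupsD[OF assms(1)]
  have "card {r \<in> R. \<forall>q\<in>Q. conjugate q r = r} mod p = card R mod p"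
    using psub_fixed_elements[OF assms(1) R(3)] normal_conjugate[OF assms(2)] Q(3) by blast
  moreover have "{r \<in> R. \<forall>q\<in>Q. conjugate q r = r} = centralizer Q \<inter> R"
  proof -
    have "conjugate q r = r \<longleftrightarrow> r \<otimes> q = q \<otimes> r"
      if "q \<in> Q" "r \<in> R" for q r
      using that Q(3) R(3) conjugate_eq_iff[of q r] by (auto simp: subset_iff)
    then show ?thesis using R(3) by (auto simp: centralizer_def)
  qed
  ultimately have "card R mod p = 1" using triv one_mod_p by simp
  obtain k where k: "card R = p ^ k" using card_psub[OF assms(3)] by blast
  have "card R \<noteq> 1" using assms(4) R(4) by (auto simp: card_1_singleton_iff)
  then have "p dvd card R" using k by (cases k) auto
  then show False using \<open>card R mod p = 1\<close> by simp
qed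

end

section \<open>Groups all of whose proper quotients are nilpotent\<close>

text \<open>\<open>R\<close> is the nilpotent residual: the lower central series has become stationary there.  The last assumption
says that all proper quotients are nilpotent.\<close>

locale just_non_nilpotent = finite_group +
  fixes R m
  assumes residual: "R = lower_central_series G m" "R = lower_central_series G (Suc m)"
    and R_ne: "R \<noteq> {\<one>}"
    and R_least: "\<And>L. L \<lhd> G \<Longrightarrow> L \<noteq> {\<one>} \<Longrightarrow> R \<subseteq> L"
begin

lemma R_normal: "R \<lhd> G" using lcs_normal residual(1) by simp

lemma R_subgroup: "subgroup R G" using R_normal normal_imp_subgroup by blast

lemma R_carrier: "R \<subseteq> carrier G" using R_subgroup subgroup.subset by blast

lemma R_not_le_one: "\<not> R \<subseteq> {\<one>}"
  using R_ne subgroup.one_closed[OF R_subgroup] by blast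

text \<open>A nontrivial center would contain \<open>R\<close>, and the next term of the lower central series would be trivial.\<close>

lemma center_trivial: "centralizer (carrier G) = {\<one>}"
proof (rule ccontr)
  assume "centralizer (carrier G) \<noteq> {\<one>}"
  then have Rc: "R \<subseteq> centralizer (carrier G)"
    using R_least centralizer_normal[OF normal_self] by blast
  have "h \<otimes> k \<otimes> inv h \<otimes> inv k = \<one>" if "h \<in> R" "k \<in> carrier G"
    for h k
  proof -
    have "h \<in> carrier G" "h \<otimes> k = k \<otimes> h" using that Rc
      by (auto simp: centralizer_def)
    then show ?thesis using that by (simp add: m_assoc)
  qed
  then have "(\<Union>h\<in>R. \<Union>k\<in>carrier G. {h \<otimes> k \<otimes> inv h \<otimes> inv k}) \<subseteq> {\<one>}" by auto
  then have "commutator_subgroup G R (carrier G) \<subseteq> {\<one>}"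
    unfolding commutator_subgroup_def using generate_subgroup_incl[OF _ triv_subgroup] by blast
  then have "R \<subseteq> {\<one>}" using residual by simp
  then show False using R_not_le_one by simp
qed

lemma frattini:
  assumes "Factorial_Ring.prime q" "T \<in> sylows q (carrier G)"
  shows "R <#> normalizer_in (carrier G) T = carrier G"
proof -
  interpret Q: finite_group_at_prime G q using assms(1) by unfold_locales
  have "central_chain (carrier G) (lower_central_series G)"
    using central_chain_lcs[OF subgroup_self] by simp
  then show ?thesis
  proof (rule Q.frattini_nilpotent_quotient[OF _ subgroup_self R_subgroup R_carrier _ _ assms(2)])
    show "carrier G \<subseteq> normalizer_in (carrier G) R"
      using normal_conjugate[OF R_normal]
        by (intro subsetI normalizer_inI[OF subgroup_self R_carrier])
    show "lower_central_series G m \<subseteq> R" using residual(1) by simp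
  qed
qed

end

locale just_non_nilpotent_core = just_non_nilpotent + finite_group_at_prime +
  assumes core: "\<Inter>Syl \<noteq> {\<one>}"
begin

lemma R_core: "R \<subseteq> \<Inter>Syl" using R_least core_normal core by blast

lemma R_psub: "R \<in> psub (carrier G)"
  using p_subgroups_subset[OF core_psub R_subgroup R_core] .

lemma no_normal_q:
  assumes "Factorial_Ring.prime q" "q \<noteq> p" "L \<lhd> G" "L \<in> p_subgroups q (carrier G)"
  shows "L = {\<one>}"
proof (rule ccontr)
  assume "L \<noteq> {\<one>}"
  then have RL: "R \<subseteq> L" using R_least assms(3) by blast
  have "x = \<one>" if x: "x \<in> R" for x
  proof -
    obtain k where k: "x [^] (p ^ k) = \<one>" using p_subgroupsD(6)[OF R_psub x] by blast
    obtain j where j: "x [^] (q ^ j) = \<one>" using p_subgroupsD(6)[OF assms(4)] x RL by blast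
    have "x \<in> carrier G" using x R_carrier by blast
    then show ?thesis using p_and_q_element[OF assms(1,2) _ k j] by simp
  qed
  then show False using R_not_le_one by blast
qed

lemma core_q_trivial:
  assumes "Factorial_Ring.prime q" "q \<noteq> p"
  shows "\<Inter>(sylows q (carrier G)) = {\<one>}"
proof -
  interpret Q: finite_group_at_prime G q using assms(1) by unfold_locales
  show ?thesis using no_normal_q[OF assms Q.core_normal Q.core_psub] .
qed

lemma R_central_in_core: "R \<subseteq> centralizer (\<Inter>Syl)"
proof -
  have "centralizer (\<Inter>Syl) \<inter> R \<noteq> {\<one>}"
    by (rule normal_psub_meets_center[OF core_psub R_normal R_psub R_ne])
  moreover have "{\<one>} \<inter> R = {\<one>}" using subgroup.one_closed[OF R_subgroup] by blast
  ultimately have "centralizer (\<Inter>Syl) \<noteq> {\<one>}" by metis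
  then show ?thesis using R_least centralizer_normal[OF core_normal] by blast
qed

lemma not_core_eq_carrier: "\<Inter>Syl \<noteq> carrier G"
proof
  assume "\<Inter>Syl = carrier G"
  then have "R \<subseteq> {\<one>}" using R_central_in_core center_trivial by simp
  then show False using R_not_le_one by simp
qed

text \<open>If all Sylow subgroups are normal, those for \<open>q \<noteq> p\<close> are trivial, since otherwise they would contain the
\<open>p\<close>-group \<open>R\<close>.  So \<open>G\<close> is a \<open>p\<close>-group and equals its core, and \<open>R\<close> would be central.\<close>

lemma ex_non_normal_sylow:
  "\<exists>q T. Factorial_Ring.prime q \<and> T \<in> sylows q (carrier G) \<and> normalizer_in (carrier G) T \<noteq> carrier G"
proof (rule ccontr)
  assume no: "\<not> ?thesis"
  have "\<exists>k. x [^] (p ^ k) = \<one>" if x: "x \<in> carrier G" for x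
  proof (rule ccontr)
    assume "\<nexists>k. x [^] (p ^ k) = \<one>"
    then obtain q where q: "Factorial_Ring.prime q" "q \<noteq> p" "q dvd ord x"
      using p_power_ord[OF x] by blast
    interpret Q: finite_group_at_prime G q using q(1) by unfold_locales
    obtain j :: nat where j: "x [^] j \<noteq> \<one>" "(x [^] j) [^] (q ^ 1) = \<one>"
      using Q.ex_power_of_order_p[OF x q(3)] by blast
    obtain T where T: "T \<in> Q.Syl" "x [^] j \<in> T"
      using Q.sylow_containing[OF subgroup_self _ j(2)] x by auto
    note Tp = p_subgroupsD[OF sylowsD[OF T(1)]]
    have "normalizer_in (carrier G) T = carrier G" using no q(1) T(1) by blast
    then have "conjugate g h \<in> T" if "g \<in> carrier G" "h \<in> T" for g h
      using normalizer_in_conjugate[of g "carrier G" T h] that by simp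
    then have "T \<lhd> G" by (rule normalI_conjugate[OF Tp(1)])
    then have "T = {\<one>}" using no_normal_q[OF q(1,2)] sylowsD[OF T(1)] by blast
    then show False using T(2) j(1) by simp
  qed
  then have G: "carrier G \<in> psub (carrier G)" by (simp add: p_subgroups_def subgroup_self)
  have "P = carrier G" if P: "P \<in> Syl" for P
  proof -
    have "P \<subseteq> carrier G" using p_subgroupsD(3)[OF sylowsD[OF P]] .
    then have "carrier G = P" using P G unfolding sylows_def by blast
    then show ?thesis by simp
  qed
  moreover obtain P where "P \<in> Syl" using ex_sylow[OF subgroup_self] by blast
  ultimately have "Syl = {carrier G}" by blast
  then have "\<Inter>Syl = carrier G" by simp
  then show False using not_core_eq_carrier by simp
qed

text \<open>The normalizer \<open>M\<close> of a Sylow subgroup that is not normal satisfies \<open>R <#> M = carrier G\<close> and does not contain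
\<open>R\<close>.  Its intersection with the centralizer of \<open>R\<close> is normalized by \<open>M\<close> and by \<open>R\<close>, hence trivial by
minimality of \<open>R\<close>.  The core centralizes \<open>R\<close>, so the \<open>M\<close>-part of each of its elements is trivial.\<close>

lemma core_eq_R: "\<Inter>Syl = R"
proof
  show "R \<subseteq> \<Inter>Syl" by (rule R_core)
  obtain q T where q: "Factorial_Ring.prime q" and T: "T \<in> sylows q (carrier G)"
    and ne: "normalizer_in (carrier G) T \<noteq> carrier G" using ex_non_normal_sylow by blast
  define M where "M = normalizer_in (carrier G) T"
  have M: "subgroup M G" unfolding M_def
    using T sylowsD p_subgroupsD(3) by (blast intro: normalizer_in_subgroup subgroup_self)
  have fr: "R <#> M = carrier G" using frattini[OF q T] by (simp add: M_def)
  have not: "\<not> R \<subseteq> M"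
  proof
    assume "R \<subseteq> M"
    then have "R <#> M \<subseteq> M" using subgroup.m_closed[OF M] unfolding set_mult_def by blast
    then show False using fr ne subgroup.subset[OF M] by (auto simp: M_def)
  qed
  \<comment> \<open>Trivial by minimality: \<open>R\<close> would otherwise lie in \<open>M\<close>.\<close>
  define D where "D = M \<inter> centralizer R"
  have D: "subgroup D G" unfolding D_def
    using subgroups_Inter_pair M subgroup_centralizer[OF R_carrier] by blast
  have "D \<lhd> G"
  proof (rule normalI_conjugate[OF D])
    fix g h assume g: "g \<in> carrier G" and h: "h \<in> D"
    have "g \<in> R <#> M" using g fr by simp
    then obtain r a where ra: "g = r \<otimes> a" "r \<in> R" "a \<in> M" unfolding set_mult_def
      by blast
    have c: "r \<in> carrier G" "a \<in> carrier G" "h \<in> carrier G"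
      using ra R_carrier subgroup.mem_carrier[OF M] subgroup.mem_carrier[OF D] h by auto
    have ah: "conjugate a h \<in> D"
      using h ra(3) conjugate_subgroup_mem[OF M] normal_conjugate[OF centralizer_normal[OF R_normal] c(2)]
      by (simp add: D_def)
    then have "conjugate a h \<otimes> r = r \<otimes> conjugate a h" using ra(2)
      by (simp add: D_def centralizer_def)
    then have "conjugate r (conjugate a h) = conjugate a h" using c by (simp add: conjugate_eq_iff)
    then show "conjugate g h \<in> D" using ah c ra(1) by (simp add: conjugate_comp)
  qed
  then have D1: "D = {\<one>}" using R_least not by (auto simp: D_def)
  show "\<Inter>Syl \<subseteq> R"
  proof
    fix x assume x: "x \<in> \<Inter>Syl"
    have xc: "x \<in> carrier G" using p_subgroupsD(3)[OF core_psub] x by blast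
    then have "x \<in> R <#> M" using fr by simp
    then obtain r a where ra: "x = r \<otimes> a" "r \<in> R" "a \<in> M" unfolding set_mult_def
      by blast
    have c: "r \<in> carrier G" "a \<in> carrier G" using ra R_carrier subgroup.mem_carrier[OF M]
      by auto
    have "a = inv r \<otimes> x" using ra(1) c by (simp add: m_assoc[symmetric])
    moreover have "inv r \<in> \<Inter>Syl"
      using ra(2) R_core subgroup.m_inv_closed[OF normal_imp_subgroup[OF core_normal]] by blast
    ultimately have "a \<in> \<Inter>Syl"
      using x subgroup.m_closed[OF normal_imp_subgroup[OF core_normal]] by simp
    then have "a \<in> centralizer R" using R_central_in_core c(2) by (auto simp: centralizer_def)
    then have "a \<in> D" using ra(3) by (simp add: D_def)
    then show "x \<in> R" using D1 ra(1,2) c by simp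
  qed
qed

text \<open>\<open>R\<close> lies in every Sylow \<open>p\<close>-subgroup, so the Frattini argument makes these normal.\<close>

lemma syl_eq_R: "Syl = {R}"
proof -
  obtain P where P: "P \<in> Syl" using ex_sylow[OF subgroup_self] by blast
  note Pp = p_subgroupsD[OF sylowsD[OF P]]
  have "R \<subseteq> normalizer_in (carrier G) P"
    using R_core P subgroup_le_normalizer_in[OF Pp(1,3)] by blast
  moreover have sub: "subgroup (normalizer_in (carrier G) P) G" using Pp(3)
    by (intro normalizer_in_subgroup subgroup_self)
  ultimately have "R <#> normalizer_in (carrier G) P \<subseteq> normalizer_in (carrier G) P"
    using subgroup.m_closed[OF sub] unfolding set_mult_def by blast
  then have "normalizer_in (carrier G) P = carrier G"
    using frattini[OF prime_p P] normalizer_in_subset[of "carrier G" P] by (metis subset_antisym)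
  then have "conjugate g ` P = P" if "g \<in> carrier G" for g using that
    by (auto simp: normalizer_in_def)
  then have "Syl \<subseteq> {P}" using sylows_conjugate[OF subgroup_self P] by auto
  then have Syl: "Syl = {P}" using P by blast
  have "P = R" using core_eq_R unfolding Syl by simp
  then show ?thesis using Syl by simp
qed

lemma p_element_in_R: "x \<in> carrier G \<Longrightarrow> x [^] (p ^ k) = \<one> \<Longrightarrow> x \<in> R"
  using sylow_containing[OF subgroup_self] syl_eq_R by blast

text \<open>In a nilpotent group elements of coprime prime power order commute, because the Sylow subgroups are normal;
and all \<open>p\<close>-elements lie in the abelian group \<open>R\<close>.  So \<open>x\<close> commutes with all powers of \<open>y\<close> of prime
power order.\<close>

lemma nil_partners_le_centralizer:
  assumes "x \<in> R"
  shows "nil_partners x \<subseteq> centralizer {x}"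
proof
  have xc: "x \<in> carrier G" using assms R_carrier by blast
  obtain i where i: "x [^] (p ^ i) = \<one>" using p_subgroupsD(6)[OF R_psub assms] by blast
  fix y assume "y \<in> nil_partners x"
  then have y: "y \<in> carrier G" "nilpotent (G\<lparr>carrier := generate G {x, y}\<rparr>)"
    by (auto simp: nil_partners_def)
  define K where "K = generate G {x, y}"
  have K: "subgroup K G" unfolding K_def using y(1) xc by (intro generate_is_subgroup) auto
  have xy: "x \<in> K" "y \<in> K" by (auto simp: K_def intro: generate.incl)
  note nilK = y(2)[folded K_def]
  obtain P where P: "P \<in> syl K" "x \<in> P" using sylow_containing[OF K xy(1) i] by blast
  note Pp = p_subgroupsD[OF sylowsD[OF P(1)]]
  show "y \<in> centralizer {x}"
  proof (rule mem_of_prime_power_parts[OF y(1)])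
    show "subgroup (centralizer {x}) G" using xc by (intro subgroup_centralizer) auto
    fix q l k :: nat
    assume q: "Factorial_Ring.prime q" and z: "(y [^] l) [^] (q ^ k) = \<one>"
    define w where "w = y [^] l"
    have w: "w \<in> carrier G" "w \<in> K" using y(1) subgroup_nat_pow[OF K xy(2)]
      by (auto simp: w_def)
    have "w \<otimes> x = x \<otimes> w"
    proof (cases "q = p")
      case True
      then have "w \<in> R" using z p_element_in_R[OF w(1)] by (simp add: w_def)
      then show ?thesis using R_central_in_core core_eq_R assms by (auto simp: centralizer_def)
    next
      case False
      interpret Q: finite_group_at_prime G q using q by unfold_locales
      obtain T where T: "T \<in> Q.syl K" "w \<in> T" using Q.sylow_containing[OF K w(2)] z
        by (auto simp: w_def)
      note Tp = p_subgroupsD[OF sylowsD[OF T(1)]]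
      define c where "c = w \<otimes> x \<otimes> inv w \<otimes> inv x"
      have "conjugate w x \<in> P"
        using nilpotent_sylow_normal[OF K nilK P(1)] w(2) P(2) normalizer_in_conjugate by blast
      then have cP: "c \<in> P" using P(2) Pp(1)
        by (simp add: c_def conjugate_def subgroup.m_closed subgroup.m_inv_closed)
      have "conjugate x (inv w) \<in> T"
        using Q.nilpotent_sylow_normal[OF K nilK T(1)] xy(1) subgroup.m_inv_closed[OF Tp(1) T(2)] normalizer_in_conjugate by blast
      then have "w \<otimes> conjugate x (inv w) \<in> T" using T(2) Tp(1)
        by (simp add: subgroup.m_closed)
      then have cT: "c \<in> T" using w xc by (simp add: c_def conjugate_def m_assoc)
      have cc: "c \<in> carrier G" using w xc by (simp add: c_def)
      obtain j where j: "c [^] (p ^ j) = \<one>" using Pp(6)[OF cP] by blast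
      obtain j' where j': "c [^] (q ^ j') = \<one>" using Tp(6)[OF cT] by blast
      have "c = \<one>" using p_and_q_element[OF q False cc j j'] .
      then have "c \<otimes> (x \<otimes> w) = x \<otimes> w" using w xc by simp
      moreover have "c \<otimes> (x \<otimes> w) = w \<otimes> x" 
      proof -
        have "c \<otimes> (x \<otimes> w) = (w \<otimes> x \<otimes> inv w) \<otimes> (inv x \<otimes> x) \<otimes> w" using w xc unfolding c_def by (simp only: m_assoc m_closed inv_closed)
        also have "\<dots> = w \<otimes> x" using w xc by (simp add: m_assoc)
        finally show ?thesis .
      qed
      ultimately show ?thesis by simp
    qed
    then show "y [^] l \<in> centralizer {x}" using w by (simp add: centralizer_def w_def)
  qed
qed

lemma dn_le: "dn G \<le> 1 / 2"
proof (rule dn_le_half[of R])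
  show "R \<subseteq> carrier G" by (rule R_carrier)
  show "\<one> \<in> R" using subgroup.one_closed[OF R_subgroup] .
  show "2 * card R \<le> order G"
    using card_proper_subgroup[OF R_subgroup] not_core_eq_carrier core_eq_R by simp
  show "2 * card (nil_partners x) \<le> order G" if x: "x \<in> R" "x \<noteq> \<one>" for x
  proof -
    have xc: "x \<in> carrier G" using x R_carrier by blast
    have "centralizer {x} \<noteq> carrier G"
    proof
      assume "centralizer {x} = carrier G"
      then have "g \<otimes> x = x \<otimes> g" if "g \<in> carrier G" for g using that
        unfolding centralizer_def by blast
      then have "x \<in> centralizer (carrier G)" using xc by (simp add: centralizer_def)
      then show False using center_trivial x by simp
    qed
    moreover have sub: "subgroup (centralizer {x}) G" using xc by (intro subgroup_centralizer) auto
    ultimately have "2 * card (centralizer {x}) \<le> order G" by (intro card_proper_subgroup)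
    moreover have "card (nil_partners x) \<le> card (centralizer {x})"
      using nil_partners_le_centralizer[OF x(1)] fin subgroup.subset[OF sub]
        by (meson card_mono finite_subset)
    ultimately show ?thesis by linarith
  qed
  show "2 * card (nil_partners x) + 2 \<le> order G" if x: "x \<in> carrier G" "x \<notin> R" for x
  proof -
    obtain q where q: "Factorial_Ring.prime q" "q \<noteq> p" "q dvd ord x"
      using p_power_ord[OF x(1)] p_element_in_R[OF x(1)] x(2) by blast
    interpret Q: finite_group_at_prime G q using q(1) by unfold_locales
    show ?thesis
      using Q.card_nil_partners_le_of_trivial_core[OF x(1) q(3)] core_q_trivial[OF q(1,2)] by blast
  qed
qed

end

context just_non_nilpotent
begin

theorem dn_le_one_half: "dn G \<le> 1 / 2"
proof (cases "\<exists>p. Factorial_Ring.prime p \<and> \<Inter>(sylows p (carrier G)) \<noteq> {\<one>}")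
  case True
  then obtain p where "Factorial_Ring.prime p" "\<Inter>(sylows p (carrier G)) \<noteq> {\<one>}"
    by blast
  then interpret just_non_nilpotent_core G R m p by unfold_locales
  show ?thesis by (rule dn_le)
next
  case False
  show ?thesis
  proof (rule dn_le_half[of "{\<one>}"])
    \<comment> \<open>With \<open>S = {\<one>}\<close> the size condition only asks for a nontrivial group.\<close>
    have "{\<one>} \<noteq> carrier G" using R_not_le_one R_carrier by metis
    then show "2 * card {\<one>} \<le> order G" by (intro card_proper_subgroup triv_subgroup)
    show "2 * card (nil_partners x) + 2 \<le> order G"
      if x: "x \<in> carrier G" "x \<notin> {\<one>}" for x
    proof -
      have "ord x \<noteq> 1" using x ord_eq_1 by blast
      then obtain q where q: "Factorial_Ring.prime q" "q dvd ord x" using prime_factor_nat by blast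
      interpret Q: finite_group_at_prime G q using q(1) by unfold_locales
      show ?thesis using Q.card_nil_partners_le_of_trivial_core[OF x(1) q(2)] False q(1) by blast
    qed
  qed auto
qed

end

section \<open>Reduction to a quotient\<close>

lemma (in group_hom) lcs_image:
  assumes "h ` carrier G = carrier H"
  shows "h ` lower_central_series G n = lower_central_series H n"
proof (induction n)
  case (Suc n)
  let ?L = "lower_central_series G n"
  have sub: "?L \<subseteq> carrier G" by (rule G.lcs_carrier)
  have comm: "h (a \<otimes> b \<otimes> inv a \<otimes> inv b) = h a \<otimes>\<^bsub>H\<^esub> h b \<otimes>\<^bsub>H\<^esub> inv\<^bsub>H\<^esub> (h a) \<otimes>\<^bsub>H\<^esub> inv\<^bsub>H\<^esub> (h b)"
    if "a \<in> carrier G" "b \<in> carrier G" for a b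
    using that by simp
  have "h ` (\<Union>a\<in>?L. \<Union>b\<in>carrier G. {a \<otimes> b \<otimes> inv a \<otimes> inv b})
      = (\<Union>a\<in>?L. \<Union>b\<in>carrier G. {h (a \<otimes> b \<otimes> inv a \<otimes> inv b)})"
    by (simp add: image_UN)
  also have "\<dots> = (\<Union>a\<in>?L. \<Union>b\<in>carrier G. {h a \<otimes>\<^bsub>H\<^esub> h b \<otimes>\<^bsub>H\<^esub> inv\<^bsub>H\<^esub> (h a) \<otimes>\<^bsub>H\<^esub> inv\<^bsub>H\<^esub> (h b)})"
    using sub by (intro SUP_cong refl) (simp add: comm subset_iff)
  also have "\<dots> = (\<Union>c\<in>h ` ?L. \<Union>d\<in>h ` carrier G. {c \<otimes>\<^bsub>H\<^esub> d \<otimes>\<^bsub>H\<^esub> inv\<^bsub>H\<^esub> c \<otimes>\<^bsub>H\<^esub> inv\<^bsub>H\<^esub> d})"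
    by simp
  finally have img: "h ` (\<Union>a\<in>?L. \<Union>b\<in>carrier G. {a \<otimes> b \<otimes> inv a \<otimes> inv b})
      = (\<Union>c\<in>lower_central_series H n. \<Union>d\<in>carrier H. {c \<otimes>\<^bsub>H\<^esub> d \<otimes>\<^bsub>H\<^esub> inv\<^bsub>H\<^esub> c \<otimes>\<^bsub>H\<^esub> inv\<^bsub>H\<^esub> d})"
    by (simp only: Suc assms)
  have "(\<Union>a\<in>?L. \<Union>b\<in>carrier G. {a \<otimes> b \<otimes> inv a \<otimes> inv b}) \<subseteq> carrier G" using sub by auto
  then show ?case
    unfolding lower_central_series.simps commutator_subgroup_def
      by (simp only: generate_img[symmetric] img)
qed (simp add: assms)

lemma (in group_hom) nilpotent_generate_image:
  assumes "x \<in> carrier G" "y \<in> carrier G" "nilpotent (G\<lparr>carrier := generate G {x, y}\<rparr>)"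
  shows "nilpotent (H\<lparr>carrier := generate H {h x, h y}\<rparr>)"
proof -
  define K where "K = generate G {x, y}"
  have K: "subgroup K G" unfolding K_def using assms(1,2) by (intro G.generate_is_subgroup) auto
  have hK: "h ` K = generate H {h x, h y}" unfolding K_def
    using generate_img[of "{x, y}"] assms(1,2) by simp
  interpret K: group_hom "G\<lparr>carrier := K\<rparr>" "H\<lparr>carrier := h ` K\<rparr>" h
    using induced_group_hom[OF K] .
  obtain n where n: "lower_central_series (G\<lparr>carrier := K\<rparr>) n = {\<one>}"
    using assms(3) by (auto simp: nilpotent_def K_def)
  have "h ` lower_central_series (G\<lparr>carrier := K\<rparr>) n = lower_central_series (H\<lparr>carrier := h ` K\<rparr>) n"
    by (rule K.lcs_image) simp
  then have "lower_central_series (H\<lparr>carrier := h ` K\<rparr>) n = {\<one>\<^bsub>H\<^esub>}"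
    using n by simp
  then show ?thesis unfolding nilpotent_def hK by auto
qed

context finite_group
begin

text \<open>A nilpotent pair lies over a nilpotent pair of cosets, and over each pair of cosets there are \<open>card N * card N\<close>
pairs of elements.\<close>

lemma dn_quotient:
  assumes "N \<lhd> G"
  shows "dn G \<le> dn (G Mod N)"
proof -
  interpret N: normal N G by fact
  let ?Q = "G Mod N"
  have NG: "subgroup N G" "N \<subseteq> carrier G" using N.subgroup_axioms N.subset by auto
  interpret f: group_hom G ?Q "\<lambda>a. N #> a"
    using N.factorgroup_is_group N.r_coset_hom_Mod by (simp add: group_hom_def group_hom_axioms_def)
  define A where "A = {(x, y) \<in> carrier G \<times> carrier G. nilpotent (G\<lparr>carrier := generate G {x, y}\<rparr>)}"
  define B where "B = {(x, y) \<in> carrier ?Q \<times> carrier ?Q. nilpotent (?Q\<lparr>carrier := generate ?Q {x, y}\<rparr>)}"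
  have cQ: "carrier ?Q = rcosets N" by (simp add: FactGroup_def)
  have finQ: "finite (carrier ?Q)" using fin by (simp add: carrier_FactGroup)
  have finB: "finite B"
    by (rule finite_subset[of _ "carrier ?Q \<times> carrier ?Q"]) (auto simp: B_def finQ)
  have cardB: "card (U \<times> V) = card N * card N" if "(U, V) \<in> B" for U V
  proof -
    have "card N = card U" "card N = card V"
      using that card_rcosets_equal[OF _ NG(2)] by (auto simp: B_def cQ)
    then show ?thesis by (simp add: card_cartesian_product)
  qed
  have finUV: "finite (U \<times> V)" if "(U, V) \<in> B" for U V
    using that rcosets_finite[OF _ NG(2)] finite_subset[OF NG(2) fin] by (auto simp: B_def cQ)
  have "A \<subseteq> (\<Union>(U, V)\<in>B. U \<times> V)"
  proof
    fix z assume "z \<in> A"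
    then obtain x y where z: "z = (x, y)" "x \<in> carrier G" "y \<in> carrier G"
      "nilpotent (G\<lparr>carrier := generate G {x, y}\<rparr>)" by (auto simp: A_def)
    then have "(N #> x, N #> y) \<in> B" using f.nilpotent_generate_image[OF z(2-4)] f.hom_closed
      by (simp add: B_def)
    moreover have "x \<in> N #> x" "y \<in> N #> y" using z NG by (auto intro: rcos_self)
    ultimately show "z \<in> (\<Union>(U, V)\<in>B. U \<times> V)" using z(1) by blast
  qed
  moreover have "finite (\<Union>(U, V)\<in>B. U \<times> V)" using finB finUV by auto
  ultimately have "card A \<le> card (\<Union>(U, V)\<in>B. U \<times> V)" by (intro card_mono)
  also have "\<dots> \<le> (\<Sum>z\<in>B. card (case z of (U, V) \<Rightarrow> U \<times> V))"
    by (rule card_UN_le[OF finB])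
  also have "\<dots> = (\<Sum>z\<in>B. card N * card N)" using cardB by (intro sum.cong) auto
  also have "\<dots> = card B * (card N * card N)" by simp
  finally have AB: "real (card A) \<le> real (card B) * (real (card N) * real (card N))"
    by (metis of_nat_le_iff of_nat_mult)
  have N0: "card N > 0" using N.finite_imp_card_positive[OF fin] .
  have Q0: "card (rcosets N) > 0" using finQ N.subgroup_in_rcosets[OF is_group] unfolding cQ
    by (auto simp: card_gt_0_iff)
  have "order G = card (rcosets N) * card N" using lagrange[OF NG(1)] by simp
  then have "dn G = real (card A) / (real (card (rcosets N)) * real (card N))\<^sup>2"
    by (simp add: dn_def A_def)
  also have "\<dots> \<le> real (card B) * (real (card N) * real (card N)) / (real (card (rcosets N)) * real (card N))\<^sup>2"
    using AB by (intro divide_right_mono) auto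
  also have "\<dots> = real (card B) / (real (card (rcosets N)))\<^sup>2" using N0 Q0
    by (simp add: field_simps power2_eq_square)
  also have "\<dots> = dn ?Q" by (simp add: dn_def B_def order_def cQ)
  finally show ?thesis .
qed

lemma lcs_stabilizes: "\<exists>m. lower_central_series G m = lower_central_series G (Suc m)"
proof -
  obtain m where m: "\<And>n. card (lower_central_series G m) \<le> card (lower_central_series G n)"
    using ex_has_least_nat[of "\<lambda>_. True" _ "\<lambda>n. card (lower_central_series G n)"]
      by auto
  have "lower_central_series G (Suc m) = lower_central_series G m"
    using lcs_decreasing[of m] m[of "Suc m"] finite_subset[OF lcs_carrier fin] by (meson card_seteq)
  then show ?thesis by metis
qed

text \<open>\<open>N\<close> is chosen maximal among the normal subgroups that do not contain the residual \<open>R\<close>.  The preimage of a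
nontrivial normal subgroup of the quotient is larger than \<open>N\<close> and therefore contains \<open>R\<close>.\<close>

lemma ex_just_non_nilpotent_quotient:
  assumes "\<not> nilpotent G"
  shows "\<exists>N R m. N \<lhd> G \<and> just_non_nilpotent (G Mod N) R m"
proof -
  obtain m where m: "lower_central_series G m = lower_central_series G (Suc m)" using lcs_stabilizes
    by blast
  define R where "R = lower_central_series G m"
  have R1: "\<one> \<in> R" "R \<noteq> {\<one>}" "R \<subseteq> carrier G"
    using normal_imp_subgroup[OF lcs_normal] assms lcs_carrier
    by (auto simp: R_def nilpotent_def subgroup.one_closed)
  define \<N> where "\<N> = {N. N \<lhd> G \<and> \<not> R \<subseteq> N}"
  have "N \<in> Pow (carrier G)" if "N \<in> \<N>" for N
    using that subgroup.subset[OF normal_imp_subgroup, of N G] by (simp add: \<N>_def)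
  then have "\<N> \<subseteq> Pow (carrier G)" by blast
  then have "finite \<N>" using fin by (meson finite_Pow_iff finite_subset)
  moreover have "{\<one>} \<in> \<N>" using R1 one_is_normal by (auto simp: \<N>_def)
  ultimately obtain N where "N \<in> \<N>" and max: "\<And>M. M \<in> \<N> \<Longrightarrow> N \<subseteq> M \<Longrightarrow> M = N"
    using finite_has_maximal[of \<N>] by blast
  then have N: "N \<lhd> G" "\<not> R \<subseteq> N" by (auto simp: \<N>_def)
  interpret N: normal N G by fact
  let ?Q = "G Mod N"
  have NG: "subgroup N G" "N \<subseteq> carrier G" using N.subgroup_axioms N.subset by auto
  interpret f: group_hom G ?Q "\<lambda>a. N #> a"
    using N.factorgroup_is_group N.r_coset_hom_Mod by (simp add: group_hom_def group_hom_axioms_def)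
  define f where "f = (\<lambda>a. N #> a)"
  have f_mem: "f a = N \<Longrightarrow> a \<in> carrier G \<Longrightarrow> a \<in> N" for a
    using rcos_self[OF _ NG(1)] unfolding f_def by metis
  have f_N: "f a = N" if "a \<in> N" for a unfolding f_def using N.rcos_const[OF is_group that] .
  have surj: "f ` carrier G = carrier ?Q" by (simp add: f_def carrier_FactGroup)
  have lcs: "f ` lower_central_series G n = lower_central_series ?Q n" for n
    unfolding f_def by (rule f.lcs_image) (use surj in \<open>simp add: f_def\<close>)
  have "just_non_nilpotent ?Q (f ` R) m"
  proof (intro just_non_nilpotent.intro finite_group.intro finite_group_axioms.intro just_non_nilpotent_axioms.intro)
    show "group ?Q" by (rule N.factorgroup_is_group)
    show "finite (carrier ?Q)" using fin surj by (metis finite_imageI)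
    show "f ` R = lower_central_series ?Q m" using lcs by (simp add: R_def)
    show "f ` R = lower_central_series ?Q (Suc m)" using lcs[of "Suc m"] m by (simp only: R_def)
    show "f ` R \<noteq> {\<one>\<^bsub>?Q\<^esub>}"
    proof
      assume "f ` R = {\<one>\<^bsub>?Q\<^esub>}"
      then have "f r = N" if "r \<in> R" for r using that by auto
      then have "R \<subseteq> N" using f_mem R1(3) by blast
      with N(2) show False by simp
    qed
    fix L assume L: "L \<lhd> ?Q" "L \<noteq> {\<one>\<^bsub>?Q\<^esub>}"
    have Ls: "subgroup L ?Q" using L(1) normal_imp_subgroup by blast
    define L' where "L' = {g \<in> carrier G. f g \<in> L}"
    have "L' \<lhd> G"
    proof -
      have "subgroup L' G"
      proof (rule subgroupI)
        show "L' \<subseteq> carrier G" by (auto simp: L'_def)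
        have "\<one> \<in> L'" using subgroup.one_closed[OF Ls] f.hom_one
          by (simp add: L'_def f_def)
        then show "L' \<noteq> {}" by blast
        show "inv a \<in> L'" if "a \<in> L'" for a
          using that subgroup.m_inv_closed[OF Ls] f.hom_inv by (simp add: L'_def f_def)
        show "a \<otimes> b \<in> L'" if "a \<in> L'" "b \<in> L'" for a b
          using that subgroup.m_closed[OF Ls] f.hom_mult by (simp add: L'_def f_def)
      qed
      moreover have "x \<otimes> h \<otimes> inv x \<in> L'" if "x \<in> carrier G" "h \<in> L'"
        for x h
      proof -
        have h: "h \<in> carrier G" "f h \<in> L" using that by (auto simp: L'_def)
        have "f (x \<otimes> h \<otimes> inv x) = f x \<otimes>\<^bsub>?Q\<^esub> f h \<otimes>\<^bsub>?Q\<^esub> inv\<^bsub>?Q\<^esub> (f x)"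
          unfolding f_def using f.hom_mult f.hom_inv that(1) h(1) by simp
        also have "\<dots> \<in> L" using L(1) h(2) surj that(1) f.H.normal_inv_iff[of L] by blast
        finally show ?thesis using that(1) h(1) by (simp add: L'_def)
      qed
      ultimately show ?thesis by (simp add: normal_inv_iff)
    qed
    have "N \<subseteq> L'"
    proof
      fix a assume "a \<in> N"
      then show "a \<in> L'" using f_N subgroup.one_closed[OF Ls] NG(2) by (auto simp: L'_def)
    qed
    obtain A where A: "A \<in> L" "A \<noteq> N" using L(2) subgroup.one_closed[OF Ls] by auto
    then have "A \<in> f ` carrier G" using surj subgroup.subset[OF Ls] by blast
    then obtain g where g: "g \<in> carrier G" "A = f g" by blast
    have "g \<in> L'" "g \<notin> N" using A g f_N by (auto simp: L'_def)
    then have "L' \<noteq> N" by blast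
    then have "L' \<notin> \<N>" using max \<open>N \<subseteq> L'\<close> by blast
    then have "R \<subseteq> L'" using \<open>L' \<lhd> G\<close> by (simp add: \<N>_def)
    then show "f ` R \<subseteq> L" by (auto simp: L'_def)
  qed
  with N(1) show ?thesis by blast
qed

theorem nilpotent_if_dn_gt_half:
  assumes "dn G > 1 / 2"
  shows "nilpotent G"
proof (rule ccontr)
  assume "\<not> nilpotent G"
  then obtain N R m where N: "N \<lhd> G" "just_non_nilpotent (G Mod N) R m"
    using ex_just_non_nilpotent_quotient by blast
  have "dn G \<le> 1 / 2" using dn_quotient[OF N(1)] just_non_nilpotent.dn_le_one_half[OF N(2)]
    by simp
  with assms show False by simp
qed

lemma subset_centralizer_swap:
  assumes "A \<subseteq> carrier G" "B \<subseteq> centralizer A"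
  shows "A \<subseteq> centralizer B"
proof
  fix a assume "a \<in> A"
  moreover have "b \<otimes> a = a \<otimes> b" if "b \<in> B" for b
    using assms(2) that \<open>a \<in> A\<close> unfolding centralizer_def by blast
  ultimately show "a \<in> centralizer B" using assms(1) by (auto simp: centralizer_def)
qed

lemma nilpotent_of_commuting:
  assumes "x \<in> carrier G" "y \<in> carrier G" "x \<otimes> y = y \<otimes> x"
  shows "nilpotent (G\<lparr>carrier := generate G {x, y}\<rparr>)"
proof -
  define K where "K = generate G {x, y}"
  have xyc: "{x, y} \<subseteq> carrier G" using assms by auto
  have K: "subgroup K G" "K \<subseteq> carrier G"
    unfolding K_def by (rule generate_is_subgroup[OF xyc], rule generate_incl[OF xyc])
  interpret K: group "G\<lparr>carrier := K\<rparr>" using subgroup_imp_group[OF K(1)] .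
  have "{x, y} \<subseteq> centralizer {x, y}" using assms by (simp add: centralizer_def)
  then have "K \<subseteq> centralizer {x, y}" unfolding K_def
    by (intro generate_subgroup_incl subgroup_centralizer xyc)
  then have "{x, y} \<subseteq> centralizer K" by (rule subset_centralizer_swap[OF xyc])
  then have KK: "K \<subseteq> centralizer K"
    using subgroup_centralizer[OF K(2)] generate_subgroup_incl[of "{x, y}" "centralizer K"]
      by (simp add: K_def)
  have "g \<otimes> h \<otimes> inv g \<otimes> inv h = \<one>" if "g \<in> K" "h \<in> K" for g h
  proof -
    have "g \<in> carrier G" "h \<in> carrier G" using that K(2) by blast+
    moreover have "g \<otimes> h = h \<otimes> g" using that KK unfolding centralizer_def by blast
    ultimately show ?thesis by (simp add: m_assoc)
  qed
  then have "(\<Union>g\<in>K. \<Union>h\<in>K. {g \<otimes> h \<otimes> inv\<^bsub>G\<lparr>carrier := K\<rparr>\<^esub> g \<otimes> inv\<^bsub>G\<lparr>carrier := K\<rparr>\<^esub> h}) \<subseteq> {\<one>}"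
    using m_inv_consistent[OF K(1)] by auto
  then have "lower_central_series (G\<lparr>carrier := K\<rparr>) (Suc 0) \<subseteq> {\<one>}"
    using K.generate_subgroup_incl[OF _ K.triv_subgroup] by (simp add: commutator_subgroup_def)
  moreover have "\<one> \<in> lower_central_series (G\<lparr>carrier := K\<rparr>) (Suc 0)"
    using subgroup.one_closed[OF normal_imp_subgroup[OF K.lcs_normal[of "Suc 0"]]] by simp
  ultimately have "lower_central_series (G\<lparr>carrier := K\<rparr>) (Suc 0) = {\<one>}" by blast
  then show ?thesis unfolding nilpotent_def K_def[symmetric]
    by (intro exI[of _ "Suc 0"]) (simp del: lower_central_series.simps)
qed

end

section \<open>The symmetric group of degree three\<close>

text \<open>The number \<open>a + 3 * b\<close> with \<open>a < 3\<close> and \<open>b < 2\<close> stands for the product of the \<open>a\<close>-th power of a 3-cycle and the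
\<open>b\<close>-th power of a transposition, which inverts the 3-cycle.\<close>

definition s3_mult :: "nat \<Rightarrow> nat \<Rightarrow> nat"
  where "s3_mult x y = (if x < 3 then (x + y) mod 3 + 3 * (y div 3)
    else (x + (3 - y mod 3)) mod 3 + 3 * (1 - y div 3))"

definition s3 :: "nat monoid"
  where "s3 = \<lparr>carrier = {..<6}, monoid.mult = s3_mult, one = 0\<rparr>"

lemma s3_simps [simp]: "monoid.mult s3 = s3_mult" "one s3 = 0"
  by (simp_all add: s3_def)

lemma carrier_s3: "carrier s3 = set [0..<6]"
  by (simp add: s3_def atLeast_upt[symmetric] lessThan_atLeast0)

lemma s3_closed: "\<forall>x\<in>set [0..<6]. \<forall>y\<in>set [0..<6]. s3_mult x y \<in> set [0..<6]"
  by code_simp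

lemma s3_assoc:
  "\<forall>x\<in>set [0..<6]. \<forall>y\<in>set [0..<6]. \<forall>z\<in>set [0..<6].
    s3_mult (s3_mult x y) z = s3_mult x (s3_mult y z)"
  by code_simp

lemma s3_unit: "0 \<in> set [0..<6] \<and> (\<forall>x\<in>set [0..<6]. s3_mult 0 x = x)"
  by code_simp

lemma s3_inverse: "\<forall>x\<in>set [0..<6]. \<exists>y\<in>set [0..<6]. s3_mult y x = 0"
  by code_simp

lemma s3_commuting:
  "length (filter (\<lambda>(x, y). s3_mult x y = s3_mult y x) (List.product [0..<6] [0..<6])) = 18"
  by code_simp

lemma group_s3: "group s3"
  using s3_closed s3_assoc s3_unit s3_inverse
  by (intro groupI) (unfold carrier_s3 s3_simps, blast+)

interpretation s3: finite_group s3
  by (intro finite_group.intro group_s3 finite_group_axioms.intro) (simp add: carrier_s3)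

lemma s3_invs: "inv\<^bsub>s3\<^esub> 1 = 2" "inv\<^bsub>s3\<^esub> 2 = 1" "inv\<^bsub>s3\<^esub> 3 = 3"
  by (rule s3.inv_equality; simp add: s3_mult_def carrier_s3)+

lemma not_nilpotent_s3: "\<not> nilpotent s3"
proof -
  have "{1, 2} \<subseteq> lower_central_series s3 n" for n
  proof (induction n)
    case (Suc n)
    have "1 \<otimes>\<^bsub>s3\<^esub> 3 \<otimes>\<^bsub>s3\<^esub> inv\<^bsub>s3\<^esub> 1 \<otimes>\<^bsub>s3\<^esub> inv\<^bsub>s3\<^esub> 3 \<in> lower_central_series s3 (Suc n)"
      "2 \<otimes>\<^bsub>s3\<^esub> 3 \<otimes>\<^bsub>s3\<^esub> inv\<^bsub>s3\<^esub> 2 \<otimes>\<^bsub>s3\<^esub> inv\<^bsub>s3\<^esub> 3 \<in> lower_central_series s3 (Suc n)"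
      using Suc by (intro s3.lcs_commutator; simp add: carrier_s3)+
    then show ?case unfolding s3_invs by (simp add: s3_mult_def del: lower_central_series.simps)
  qed (simp add: carrier_s3)
  then have "lower_central_series s3 n \<noteq> {\<one>\<^bsub>s3\<^esub>}" for n
    by (metis insert_subset singletonD s3_simps(2) zero_neq_one)
  then show ?thesis by (simp add: nilpotent_def)
qed

lemma dn_s3: "dn s3 \<ge> 1 / 2"
proof -
  define C where "C = {(x, y) \<in> carrier s3 \<times> carrier s3. s3_mult x y = s3_mult y x}"
  define A where "A = {(x, y) \<in> carrier s3 \<times> carrier s3. nilpotent (s3\<lparr>carrier := generate s3 {x, y}\<rparr>)}"
  have "C = set (filter (\<lambda>(x, y). s3_mult x y = s3_mult y x) (List.product [0..<6] [0..<6]))"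
    unfolding C_def carrier_s3 by (auto simp only: set_filter set_product)
  then have "card C = 18"
    using s3_commuting by (simp only: distinct_card distinct_filter distinct_product distinct_upt)
  moreover have "C \<subseteq> A" using s3.nilpotent_of_commuting by (auto simp: C_def A_def)
  moreover have "finite A"
    by (rule finite_subset[of _ "carrier s3 \<times> carrier s3"]) (auto simp: A_def carrier_s3)
  ultimately have "18 \<le> card A" by (metis card_mono)
  then have "18 / 36 \<le> dn s3" unfolding dn_def A_def[symmetric] order_def
    by (simp add: power2_eq_square carrier_s3)
  then show ?thesis by simp
qed

theorem theorem1p1:
  shows "(\<forall>G :: ('a, 'b) monoid_scheme.
            group G \<and> finite (carrier G) \<and> dn G > 1 / 2 \<longrightarrow> nilpotent G) \<and>
         (\<forall>c :: real. c < 1 / 2 \<longrightarrow>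
            (\<exists>H :: nat monoid.
               group H \<and> finite (carrier H) \<and> \<not> nilpotent H \<and> dn H > c))"
proof (intro conjI allI impI)
  fix G :: "('a, 'b) monoid_scheme"
  assume G: "group G \<and> finite (carrier G) \<and> dn G > 1 / 2"
  then interpret finite_group G by (simp add: finite_group_def finite_group_axioms_def)
  show "nilpotent G" using G nilpotent_if_dn_gt_half by blast
next
  fix c :: real assume "c < 1 / 2"
  then have "dn s3 > c" using dn_s3 by linarith
  then show "\<exists>H :: nat monoid. group H \<and> finite (carrier H) \<and> \<not> nilpotent H \<and> dn H > c"
    using group_s3 s3.fin not_nilpotent_s3 by blast
qed

end
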